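(* Let $E\subset\mathbb{R}$ be a finite union of disjoint closed bounded intervals, and let $\mu$ be a measure on $\mathbb{R}$ of compact support with $\sigma_{\mathrm{ess}}(\mu)=E$. Suppose that for every $\eta>0$, $$\lim_{m\to\infty}\Bigl|\bigl\{x\in E:\ \mu([x-\tfrac1m,x+\tfrac1m])\le e^{-m\eta}\bigr\}\Bigr|=0,$$ where $|\cdot|$ is Lebesgue measure. Then $\mu$ is regular. *)

theory Defs
  imports "HOL-Probability.Probability" "HOL-Computational_Algebra.Polynomial"
begin

definition msupp :: "real measure \<Rightarrow> real set" where
  "msupp \<mu> = {x. \<forall>e>0. emeasure \<mu> (ball x e) > 0}"

definition sigma_ess :: "real measure \<Rightarrow> real set" where
  "sigma_ess \<mu> = {x \<in> msupp \<mu>. x islimpt msupp \<mu>}"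

text \<open>Logarithmic kernel log(1/|x-y|), split into positive and negative parts.\<close>
definition logk_pos :: "real \<Rightarrow> real \<Rightarrow> ennreal" where
  "logk_pos x y = (if x = y then \<infinity> else ennreal (ln (1 / \<bar>x - y\<bar>)))"

definition logk_neg :: "real \<Rightarrow> real \<Rightarrow> ennreal" where
  "logk_neg x y = ennreal (ln \<bar>x - y\<bar>)"

definition log_energy :: "real measure \<Rightarrow> ereal" where
  "log_energy \<nu> =
     enn2ereal (\<integral>\<^sup>+ x. \<integral>\<^sup>+ y. logk_pos x y \<partial>\<nu> \<partial>\<nu>)
   - enn2ereal (\<integral>\<^sup>+ x. \<integral>\<^sup>+ y. logk_neg x y \<partial>\<nu> \<partial>\<nu>)"

definition log_capacity :: "real set \<Rightarrow> real" where
  "log_capacity K =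
     (let I = (INF \<nu> \<in> {\<nu>. prob_space \<nu> \<and> sets \<nu> = sets borel \<and> emeasure \<nu> (UNIV - K) = 0}.
                 log_energy \<nu>)
      in if I = \<infinity> then 0 else exp (- real_of_ereal I))"

text \<open>L^2(mu)-norm of the monic orthogonal polynomial of degree n, i.e. the minimum of
  the L^2(mu)-norms of the real monic polynomials of degree n.\<close>
definition monic_OP_norm :: "real measure \<Rightarrow> nat \<Rightarrow> real" where
  "monic_OP_norm \<mu> n =
     (INF p \<in> {p :: real poly. degree p = n \<and> lead_coeff p = 1}.
        sqrt (\<integral>x. (poly p x)\<^sup>2 \<partial>\<mu>))"

definition regular_measure :: "real measure \<Rightarrow> bool" where
  "regular_measure \<mu> \<longleftrightarrow>
     (\<lambda>n. monic_OP_norm \<mu> n powr (1 / real n)) \<longlonglongrightarrow> log_capacity (sigma_ess \<mu>)"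

end

(* Let gamma_n be the least norm of a monic polynomial of degree n. Greedily chosen (Leja) points of E produce, for every
   c > cap E, a monic T with |T| <= c^(deg T) on E: otherwise the pairwise energies of these points would,
   after smearing each point over a short interval, give a measure on E of energy below the minimum.
   Powers of T, times the factors vanishing at the finitely many remaining points of the support, are
   competitors for gamma_n.

   For the lower bound, let P be monic of degree n with norm below c^n, c < cap E. Take a measure on E of
   bounded density and nearly minimal energy and, by the first moment method, (k+1)n points with nearly
   minimal pairwise energy. Few of them lie in the small bad set where mu([x-1/m, x+1/m]) is tiny
   (m = Hn), and few pairs are closer than a multiple of 1/m. After deleting these, kn points x_i remain,
   and P is at most about c^n at some y_i within 1/m of x_i. Passing from x_i to y_i hardly changes the
   Vandermonde product, which is about (cap E)^((kn)^2/2). On the other hand, expanding it in the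
   polynomials P^q x^r bounds it by about c^((kn)^2/2), which is a contradiction. *)

theory Submission
  imports Defs
begin

section \<open>Smearing point configurations\<close>

text \<open>The order in which the parameters are chosen carries the lower bound. Evaluating
  \<open>P\<close> near a point outside the bad set costs \<open>exp (m * \<eta> / 2)\<close>, that
  is \<open>H * \<eta> / 2\<close> per degree, so \<open>\<eta>\<close> must be small against 1/H.
  The scale 1/m must in turn be short against 1/n: every close pair is charged
  \<open>al * n\<close>, the charge that leaves at most n bad points within a budget of order n^2.
  Two random points are close with probability of order 1/(H n), so the charge raises the energy per
  pair by a multiple of \<open>al / H\<close>, and H has to be large. Hence k is fixed first, then
  \<open>al\<close>, then H, and last \<open>\<eta>\<close>; the hypothesis is used at this small
  \<open>\<eta>\<close>. A bounded density turns the Lebesgue measure of the bad set and of short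
  intervals into probability. A measure with such a density and nearly minimal energy arises by
  smearing the points of a nearly optimal configuration, the same device that serves the upper
  bound, so no equilibrium measure enters. The kernel is shifted to be nonnegative, so that energies
  live in \<open>ennreal\<close> and deleting points never increases them.\<close>

definition prob_on :: "real set \<Rightarrow> real measure set" where
  "prob_on E = {\<nu>. prob_space \<nu> \<and> sets \<nu> = sets borel \<and> emeasure \<nu> (UNIV - E) = 0}"

text \<open>The kernel \<open>log (1/|x-y|)\<close> shifted by \<open>log D\<close>, so that it is nonnegative on sets of diameter
  at most \<open>D\<close>; for \<open>|x-y| > D\<close> the coercion truncates it to 0.\<close>

definition log_kern :: "real \<Rightarrow> real \<Rightarrow> real \<Rightarrow> ennreal" where
  "log_kern D x y = (if x = y then \<infinity> else ennreal (ln (D / \<bar>x - y\<bar>)))"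

lemma log_kern_commute: "log_kern D x y = log_kern D y x"
  by (auto simp: log_kern_def abs_minus_commute)

lemma measurable_log_kern [measurable]:
  "(\<lambda>(x, y). log_kern D x y) \<in> borel_measurable (borel \<Otimes>\<^sub>M borel)"
  unfolding log_kern_def by measurable

section \<open>Choosing points by averaging\<close>

lemma prob_on_exists_le_nn_integral:
  assumes nu: "\<nu> \<in> prob_on E" and f [measurable]: "f \<in> borel_measurable borel" and E: "E \<in> sets borel"
  shows "\<exists>x\<in>E. f x \<le> (\<integral>\<^sup>+ y. f y \<partial>\<nu>)"
proof (rule ccontr)
  assume neg: "\<not> ?thesis"
  define c where "c = (\<integral>\<^sup>+ y. f y \<partial>\<nu>)"
  interpret prob_space \<nu> using nu by (simp add: prob_on_def)
  have s [measurable_cong]: "sets \<nu> = sets borel" using nu by (simp add: prob_on_def)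
  have "UNIV - E \<in> null_sets \<nu>"
    using nu E s by (auto simp: prob_on_def null_sets_def)
  then have AE: "AE x in \<nu>. x \<in> E" by (rule AE_I') auto
  from neg have gt: "\<And>x. x \<in> E \<Longrightarrow> c < f x" by (auto simp: c_def not_le)
  have "(\<integral>\<^sup>+ y. c \<partial>\<nu>) < (\<integral>\<^sup>+ y. f y \<partial>\<nu>)"
  proof (rule nn_integral_less)
    \<comment> \<open>Strict comparison needs a finite smaller integral; an infinite mean could not
      be exceeded anywhere on \<open>E\<close>, which carries the full mass.\<close>
    have "c \<noteq> \<infinity>"
    proof
      assume "c = \<infinity>"
      then have "AE x in \<nu>. False" using eventually_mono[OF AE, of "\<lambda>_. False"] gt by (metis infinity_ennreal_def top.not_eq_extremum less_le_trans not_less_iff_gr_or_eq top_greatest not_le)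
      then show False by simp
    qed
    then show "(\<integral>\<^sup>+ y. c \<partial>\<nu>) \<noteq> \<infinity>" by (simp add: emeasure_space_1)
    show "AE x in \<nu>. c \<le> f x" by (rule eventually_mono[OF AE]) (use gt in \<open>auto intro: less_imp_le\<close>)
    show "\<not> (AE x in \<nu>. f x \<le> c)"
    proof
      assume "AE x in \<nu>. f x \<le> c"
      then have "AE x in \<nu>. False" using AE
        by eventually_elim (use gt in force)
      then show False by simp
    qed
  qed auto
  then show False by (simp add: emeasure_space_1 c_def)
qed

text \<open>The first moment method for tuples; the points are chosen one after the other, and the
  interaction with the points already chosen is absorbed into the external field \<open>h\<close>.\<close>

lemma exists_tuple_le_energy:
  assumes nu: "\<nu> \<in> prob_on E" and E: "E \<in> sets borel"
    and g: "(\<lambda>(x, y). g x y) \<in> borel_measurable (borel \<Otimes>\<^sub>M borel)"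
    and h: "h \<in> borel_measurable borel"
  shows "\<exists>x. (\<forall>i<k. x i \<in> E) \<and>
     (\<Sum>i<k. h (x i)) + (\<Sum>i<k. \<Sum>j<i. g (x i) (x j))
       \<le> of_nat k * (\<integral>\<^sup>+ x. h x \<partial>\<nu>) + of_nat (\<Sum>i<k. i) * (\<integral>\<^sup>+ x. \<integral>\<^sup>+ y. (g y x :: ennreal) \<partial>\<nu> \<partial>\<nu>)"
  using h
proof (induction k arbitrary: h)
  case 0
  show ?case by simp
next
  case (Suc k)
  note [measurable] = g Suc.prems
  interpret prob_space \<nu> using nu by (simp add: prob_on_def)
  have s [measurable_cong]: "sets \<nu> = sets borel" using nu by (simp add: prob_on_def)
  define G where "G = (\<integral>\<^sup>+ x. \<integral>\<^sup>+ y. g y x \<partial>\<nu> \<partial>\<nu>)"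
  define H where "H = (\<integral>\<^sup>+ x. h x \<partial>\<nu>)"
  \<comment> \<open>\<open>F z\<close> bounds the cost once \<open>z\<close> is chosen: its own
    field value plus the induction hypothesis for \<open>k\<close> further points in the field
    \<open>\<lambda>y. h y + g y z\<close>. The mean of \<open>F\<close> is exactly the bound for
    \<open>Suc k\<close> points, so any \<open>z\<close> with \<open>F z\<close> at most the mean
    will do.\<close>
  define F where "F = (\<lambda>z. h z + (of_nat k * (\<integral>\<^sup>+ y. h y + g y z \<partial>\<nu>) + of_nat (\<Sum>i<k. i) * G))"
  have F: "F \<in> borel_measurable borel" unfolding F_def by measurable
  have Fz: "F z = h z + (of_nat k * (H + (\<integral>\<^sup>+ y. g y z \<partial>\<nu>)) + of_nat (\<Sum>i<k. i) * G)" for z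
    unfolding F_def H_def by (subst nn_integral_add) auto
  have intF: "(\<integral>\<^sup>+ z. F z \<partial>\<nu>) = H + (of_nat k * (H + G) + of_nat (\<Sum>i<k. i) * G)"
  proof -
    have "(\<integral>\<^sup>+ z. F z \<partial>\<nu>) = H + (\<integral>\<^sup>+ z. of_nat k * (H + (\<integral>\<^sup>+ y. g y z \<partial>\<nu>)) + of_nat (\<Sum>i<k. i) * G \<partial>\<nu>)"
      unfolding Fz H_def by (rule nn_integral_add) auto
    also have "(\<integral>\<^sup>+ z. of_nat k * (H + (\<integral>\<^sup>+ y. g y z \<partial>\<nu>)) + of_nat (\<Sum>i<k. i) * G \<partial>\<nu>)
       = (\<integral>\<^sup>+ z. of_nat k * (H + (\<integral>\<^sup>+ y. g y z \<partial>\<nu>)) \<partial>\<nu>) + of_nat (\<Sum>i<k. i) * G"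
      by (subst nn_integral_add) (auto simp: emeasure_space_1)
    also have "(\<integral>\<^sup>+ z. of_nat k * (H + (\<integral>\<^sup>+ y. g y z \<partial>\<nu>)) \<partial>\<nu>) = of_nat k * (\<integral>\<^sup>+ z. H + (\<integral>\<^sup>+ y. g y z \<partial>\<nu>) \<partial>\<nu>)"
      by (rule nn_integral_cmult) auto
    also have "(\<integral>\<^sup>+ z. H + (\<integral>\<^sup>+ y. g y z \<partial>\<nu>) \<partial>\<nu>) = H + G"
      unfolding G_def by (subst nn_integral_add) (auto simp: emeasure_space_1)
    finally show ?thesis .
  qed
  obtain z where z: "z \<in> E" "F z \<le> (\<integral>\<^sup>+ y. F y \<partial>\<nu>)"
    using prob_on_exists_le_nn_integral[OF nu F E] by auto
  have "(\<lambda>y. h y + g y z) \<in> borel_measurable borel" by measurable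
  from Suc.IH[OF this] obtain x where x: "\<forall>i<k. x i \<in> E"
    and le: "(\<Sum>i<k. h (x i) + g (x i) z) + (\<Sum>i<k. \<Sum>j<i. g (x i) (x j))
       \<le> of_nat k * (\<integral>\<^sup>+ y. h y + g y z \<partial>\<nu>) + of_nat (\<Sum>i<k. i) * G"
    by (auto simp: G_def)
  \<comment> \<open>The new point gets index 0 and so stands second in each pair
    \<open>j < i\<close>, just as in the field \<open>\<lambda>y. h y + g y z\<close>.\<close>
  define x' where "x' = case_nat z x"
  have "(\<Sum>i<Suc k. h (x' i)) + (\<Sum>i<Suc k. \<Sum>j<i. g (x' i) (x' j))
      = h z + ((\<Sum>i<k. h (x i) + g (x i) z) + (\<Sum>i<k. \<Sum>j<i. g (x i) (x j)))"
    by (simp add: sum.lessThan_Suc_shift x'_def sum.distrib add_ac del: sum.lessThan_Suc)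
  also have "\<dots> \<le> F z" unfolding F_def by (intro add_left_mono le)
  also have "\<dots> \<le> H + (of_nat k * (H + G) + of_nat (\<Sum>i<k. i) * G)" using z intF by simp
  also have "\<dots> = of_nat (Suc k) * H + of_nat (\<Sum>i<Suc k. i) * G"
    by (simp add: algebra_simps)
  finally have "(\<Sum>i<Suc k. h (x' i)) + (\<Sum>i<Suc k. \<Sum>j<i. g (x' i) (x' j))
     \<le> of_nat (Suc k) * H + of_nat (\<Sum>i<Suc k. i) * G" .
  moreover have "\<forall>i<Suc k. x' i \<in> E"
    using x z by (auto simp: x'_def split: nat.split)
  ultimately show ?case unfolding H_def G_def by blast
qed

section \<open>Averages of the logarithmic kernel over short intervals\<close>

text \<open>The logarithm gains \<open>ln 2\<close> with each halving of the distance below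
  \<open>r\<close>, and the dyadic intervals around \<open>x\<close> containing \<open>y\<close>
  count these halvings. Integrals of the kernel are thereby reduced to lengths of intervals. On the
  diagonal the count is infinite, as is the kernel.\<close>

lemma log_kern_le_dyadic:
  assumes r: "0 < r" "r \<le> D"
  shows "log_kern D x y \<le> ennreal (ln (D / r)) +
    (\<Sum>k. ennreal (ln 2) * indicator {x - r * (1/2)^k .. x + r * (1/2)^k} y)"
    (is "_ \<le> _ + ?S")
proof -
  have sum_ge: "ennreal (real (Suc m) * ln 2) \<le> ?S" if "\<bar>x - y\<bar> \<le> r * (1/2)^m" for m
  proof -
    have "indicator {x - r * (1/2)^k .. x + r * (1/2)^k} y = (1::ennreal)" if "k \<in> {..<Suc m}" for k
    proof -
      have "(1/2::real)^m \<le> (1/2)^k" using that by (intro power_decreasing) auto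
      then have "r * (1/2)^m \<le> r * (1/2)^k" using r by simp
      then show ?thesis using \<open>\<bar>x - y\<bar> \<le> r * (1/2)^m\<close> by (auto simp: indicator_def)
    qed
    then have "(\<Sum>k<Suc m. ennreal (ln 2) * indicator {x - r * (1/2)^k .. x + r * (1/2)^k} y)
        = (\<Sum>k<Suc m. ennreal (ln 2))" by (intro sum.cong) auto
    also have "\<dots> = ennreal (real (Suc m) * ln 2)"
      by (simp only: sum_constant card_lessThan) (simp add: ennreal_mult ennreal_of_nat_eq_real_of_nat)
    finally show ?thesis
      using sum_le_suminf[OF summableI, of "{..<Suc m}" "\<lambda>k. ennreal (ln 2) * indicator {x - r * (1/2)^k .. x + r * (1/2)^k} y"]
      by (simp del: sum.lessThan_Suc)
  qed
  have D: "0 < D" using r by simp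
  show ?thesis
  proof (cases "x = y")
    case True
    have "?S = \<infinity>"
    proof (rule ccontr)
      assume "?S \<noteq> \<infinity>"
      then obtain s where s: "?S = ennreal s" "s \<ge> 0" by (cases ?S) auto
      have "0 < ln (2::real)" by simp
      from reals_Archimedean3[OF this] obtain m where m: "s < real m * ln 2" by blast
      have "\<bar>x - y\<bar> \<le> r * (1/2)^m" using True r by simp
      from sum_ge[OF this] have "ennreal (real (Suc m) * ln 2) \<le> ennreal s" unfolding s(1) .
      then have "real (Suc m) * ln 2 \<le> s" using s by (simp add: ennreal_le_iff)
      moreover have "real m * ln 2 \<le> real (Suc m) * ln 2" by (intro mult_right_mono) auto
      ultimately show False using m by linarith
    qed
    then show ?thesis by simp
  next
    case False
    define t where "t = \<bar>x - y\<bar>"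
    have t: "0 < t" using False by (simp add: t_def)
    show ?thesis
    proof (cases "r < t")
      case True
      then have "ln (D / t) \<le> ln (D / r)" using t r D by (simp add: frac_le)
      then have "log_kern D x y \<le> ennreal (ln (D / r))"
        using False by (simp add: log_kern_def t_def ennreal_leI)
      then show ?thesis by (rule order_trans) simp
    next
      case le: False
      \<comment> \<open>Take the least such \<open>n\<close>. By minimality the intervals with index
        below \<open>n\<close> all contain \<open>y\<close>, and \<open>n\<close> copies of
        \<open>ln 2\<close> make up for \<open>ln (r / t)\<close>.\<close>
      have "\<exists>n. (1/2::real)^n < t / r" using t r by (intro real_arch_pow_inv) auto
      then obtain n where n: "(1/2::real)^n < t / r" "\<And>k. k < n \<Longrightarrow> \<not> (1/2::real)^k < t / r"
        using exists_least_iff[of "\<lambda>n. (1/2::real)^n < t / r"] by blast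
      have "n \<noteq> 0" using n le t r by (cases n) auto
      then obtain m where m: "n = Suc m" by (cases n) auto
      have "t \<le> r * (1/2)^m" using n(2)[of m] m r by (simp add: field_simps)
      note ge = sum_ge[of m, folded t_def, OF this]
      have "r / t \<le> 2 ^ n" using n(1) t r by (simp add: field_simps power_divide)
      then have "ln (r / t) \<le> ln (2 ^ n)" using t r by (intro ln_mono) auto
      then have l: "ln (r / t) \<le> real (Suc m) * ln 2" by (simp only: m ln_realpow zero_less_numeral)
      have "ln (D / t) = ln (D / r) + ln (r / t)" using t r D by (simp add: ln_div)
      then have "log_kern D x y \<le> ennreal (ln (D / r) + real (Suc m) * ln 2)"
        using False l by (simp add: log_kern_def t_def ennreal_leI)
      also have "\<dots> = ennreal (ln (D / r)) + ennreal (real (Suc m) * ln 2)"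
        using r by (intro ennreal_plus) auto
      also have "\<dots> \<le> ennreal (ln (D / r)) + ?S" by (intro add_left_mono ge)
      finally show ?thesis .
    qed
  qed
qed

text \<open>The dyadic intervals have total length \<open>4 * r\<close>, and
  \<open>ln 2 < 1\<close>; this is the origin of the 4. The series is integrated over the whole
  line, so the bound does not depend on where \<open>x\<close> lies relative to the window.\<close>

lemma nn_integral_log_kern_interval:
  assumes r: "0 < r" "r \<le> D"
  shows "(\<integral>\<^sup>+ y. log_kern D x y * indicator {u..u + r} y \<partial>lborel) \<le> ennreal (r * (ln (D / r) + 4))"
proof -
  let ?I = "\<lambda>k y. ennreal (ln 2) * indicator {x - r * (1/2)^k .. x + r * (1/2)^k} y"
  have "(\<integral>\<^sup>+ y. log_kern D x y * indicator {u..u + r} y \<partial>lborel)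
      \<le> (\<integral>\<^sup>+ y. ennreal (ln (D / r)) * indicator {u..u + r} y + (\<Sum>k. ?I k y) \<partial>lborel)"
  proof (rule nn_integral_mono)
    fix y
    show "log_kern D x y * indicator {u..u + r} y
       \<le> ennreal (ln (D / r)) * indicator {u..u + r} y + (\<Sum>k. ?I k y)"
      using log_kern_le_dyadic[OF r, of x y] by (auto simp: indicator_def split: if_splits)
  qed
  also have "\<dots> = ennreal (ln (D / r)) * ennreal r + (\<integral>\<^sup>+ y. (\<Sum>k. ?I k y) \<partial>lborel)"
    using r by (subst nn_integral_add) (auto simp: nn_integral_cmult)
  also have "(\<integral>\<^sup>+ y. (\<Sum>k. ?I k y) \<partial>lborel) = (\<Sum>k. \<integral>\<^sup>+ y. ?I k y \<partial>lborel)"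
    by (intro nn_integral_suminf) auto
  also have "\<dots> = (\<Sum>k. ennreal (2 * r * ln 2 * (1/2)^k))"
  proof (intro suminf_cong)
    fix k
    have "(\<integral>\<^sup>+ y. ?I k y \<partial>lborel) = ennreal (ln 2) * ennreal (2 * (r * (1/2)^k))"
      using r by (subst nn_integral_cmult) auto
    also have "\<dots> = ennreal (ln 2 * (2 * (r * (1/2)^k)))" using r by (intro ennreal_mult[symmetric]) auto
    also have "ln 2 * (2 * (r * (1/2)^k)) = 2 * r * ln 2 * (1/2)^k" by (simp only: mult_ac)
    finally show "(\<integral>\<^sup>+ y. ?I k y \<partial>lborel) = ennreal (2 * r * ln 2 * (1/2)^k)" .
  qed
  also have "\<dots> = ennreal (2 * r * ln 2 * 2)"
  proof (rule suminf_ennreal_eq)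
    show "(\<lambda>k. 2 * r * ln 2 * (1/2)^k) sums (2 * r * ln 2 * 2)"
      using geometric_sums[of "1/2::real"] by (intro sums_mult) auto
  qed (use r in auto)
  also have "ennreal (ln (D / r)) * ennreal r + ennreal (2 * r * ln 2 * 2)
     = ennreal (r * ln (D / r) + 4 * r * ln 2)"
    using r by (subst ennreal_mult[symmetric]) (auto simp: ennreal_plus[symmetric] mult_ac simp del: ennreal_plus)
  also have "\<dots> \<le> ennreal (r * (ln (D / r) + 4))"
  proof (rule ennreal_leI)
    have "r * ln 2 \<le> r * 1" using r ln_2_less_1 by (intro mult_left_mono) auto
    then show "r * ln (D / r) + 4 * r * ln 2 \<le> r * (ln (D / r) + 4)" by (simp add: algebra_simps)
  qed
  finally show ?thesis .
qed

text \<open>If \<open>x\<close> and \<open>y\<close> are at least \<open>K * r\<close> apart, moving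
  each within its window changes the kernel by a small additive amount. If they are closer, the
  average is at most \<open>ln (D / r) + 4\<close> while the kernel at \<open>(x, y)\<close> is at
  least \<open>ln (D / (K * r))\<close>; the difference \<open>ln K + 4\<close> is constant, and for
  small \<open>r\<close> it is a small fraction of the kernel itself. Hence one additive and one
  multiplicative error.\<close>

lemma log_kern_average_le:
  assumes D: "0 < D" and e: "0 < e" and th: "0 < th" and r0: "0 < r0"
  shows "\<exists>r. 0 < r \<and> r \<le> r0 \<and> r \<le> D \<and> (\<forall>x y u v. u \<le> x \<longrightarrow> x \<le> u + r \<longrightarrow> v \<le> y \<longrightarrow> y \<le> v + r \<longrightarrow>
     (\<integral>\<^sup>+ s. (\<integral>\<^sup>+ t. log_kern D s t * indicator {v..v + r} t \<partial>lborel) * indicator {u..u + r} s \<partial>lborel)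
       \<le> ennreal (r\<^sup>2) * (ennreal (1 + th) * log_kern D x y + ennreal e))"
proof -
  \<comment> \<open>\<open>4 \<le> K\<close> keeps \<open>1 - 2 / K\<close> above one half, and then
    \<open>4 / K \<le> e\<close> bounds the logarithmic change in the far case.\<close>
  define K where "K = 4 + 4 / e"
  have K: "4 \<le> K" "4 / K \<le> e" using e by (auto simp: K_def field_simps)
  \<comment> \<open>The last term is the solution of
    \<open>th * ln (D / (K * r)) = ln K + 4\<close>, as the near case demands.\<close>
  define r where "r = min (min r0 D) (D / K * exp (- ((ln K + 4) / th)))"
  have r: "0 < r" "r \<le> r0" "r \<le> D" using D r0 K by (auto simp: r_def)
  have "r \<le> D / K * exp (- ((ln K + 4) / th))" by (simp add: r_def)
  then have "exp ((ln K + 4) / th) \<le> D / (K * r)"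
    using r K by (simp add: field_simps exp_minus)
  then have "(ln K + 4) / th \<le> ln (D / (K * r))"
    using r K D by (simp add: ln_ge_iff)
  then have small: "ln K + 4 \<le> th * ln (D / (K * r))" using th by (simp add: field_simps)
  have "ln (D / r) = ln K + ln (D / (K * r))" using D r K by (simp add: ln_div ln_mult)
  with small have W: "ln (D / r) + 4 \<le> (1 + th) * ln (D / (K * r))" by (simp add: algebra_simps)
  have lK: "0 \<le> ln (D / (K * r))"
  proof -
    have "0 \<le> ln K" using K by simp
    then have "0 \<le> th * ln (D / (K * r))" using small by linarith
    then show ?thesis using th by (simp add: zero_le_mult_iff)
  qed
  have main: "(\<integral>\<^sup>+ s. (\<integral>\<^sup>+ t. log_kern D s t * indicator {v..v + r} t \<partial>lborel) * indicator {u..u + r} s \<partial>lborel)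
       \<le> ennreal (r\<^sup>2) * (ennreal (1 + th) * log_kern D x y + ennreal e)" (is "?L \<le> _")
    if xu: "u \<le> x" "x \<le> u + r" and yv: "v \<le> y" "y \<le> v + r" for x y u v
  proof -
    have int_r: "(\<integral>\<^sup>+ t. c * indicator {w..w + r} t \<partial>lborel) = c * ennreal r" for c w
      using r by (subst nn_integral_cmult) auto
    show ?thesis
    proof (cases "K * r \<le> \<bar>x - y\<bar>")
      case True
      have "?L \<le> (\<integral>\<^sup>+ s. (\<integral>\<^sup>+ t. (log_kern D x y + ennreal e) * indicator {v..v + r} t \<partial>lborel) * indicator {u..u + r} s \<partial>lborel)"
      proof (intro nn_integral_mono)
        fix s
        show "(\<integral>\<^sup>+ t. log_kern D s t * indicator {v..v + r} t \<partial>lborel) * indicator {u..u + r} s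
           \<le> (\<integral>\<^sup>+ t. (log_kern D x y + ennreal e) * indicator {v..v + r} t \<partial>lborel) * indicator {u..u + r} s"
        proof (cases "s \<in> {u..u + r}")
          case s: True
          have "log_kern D s t \<le> log_kern D x y + ennreal e" if t: "t \<in> {v..v + r}" for t
          proof -
            define d where "d = \<bar>x - y\<bar>"
            have d: "0 < d" "K * r \<le> d" using True r K
              by (auto simp: d_def) (smt (verit) mult_pos_pos)
            then have dx: "x \<noteq> y" by (auto simp: d_def)
            have rd: "r \<le> d / K" using d K by (simp add: field_simps)
            have dst: "d * (1 - 2 / K) \<le> \<bar>s - t\<bar>"
            proof -
              have "d * (1 - 2 / K) = d - 2 * (d / K)" by (simp add: algebra_simps)
              also have "\<dots> \<le> d - 2 * r" using rd by simp
              also have "\<dots> \<le> \<bar>s - t\<bar>" using s t xu yv by (auto simp: d_def)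
              finally show ?thesis .
            qed
            have k1: "1 - 2 / K \<ge> 1 / 2" using K by (simp add: field_simps)
            then have pos: "0 < d * (1 - 2 / K)" using d by simp
            then have st: "s \<noteq> t" using dst by auto
            have "- ln (1 - 2 / K) = ln (1 / (1 - 2 / K))" using k1 by (subst ln_div) auto
            also have "\<dots> \<le> 1 / (1 - 2 / K) - 1" using k1 by (intro ln_le_minus_one) auto
            also have "\<dots> \<le> 4 / K" using k1 K by (simp add: field_simps)
            finally have lnK: "- ln (1 - 2 / K) \<le> e" using K by linarith
            have "ln (D / \<bar>s - t\<bar>) = ln D - ln \<bar>s - t\<bar>" using st D by (simp add: ln_div)
            also have "\<dots> \<le> ln D - ln (d * (1 - 2 / K))" using pos dst by simp
            also have "\<dots> = ln D - ln d - ln (1 - 2 / K)" using ln_mult_pos[of d "1 - 2 / K"] k1 d by linarith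
            also have "\<dots> = ln (D / d) - ln (1 - 2 / K)" using D d by (simp add: ln_div)
            also have "\<dots> \<le> ln (D / d) + e" using lnK by simp
            finally have "log_kern D s t \<le> ennreal (ln (D / d) + e)"
              using st by (simp add: log_kern_def ennreal_leI)
            also have "\<dots> \<le> ennreal (ln (D / d)) + ennreal e" using e
              by (cases "ln (D / d) \<ge> 0") (simp_all add: ennreal_neg ennreal_leI)
            finally show ?thesis using dx by (simp add: log_kern_def d_def)
          qed
          then have "log_kern D s t * indicator {v..v + r} t \<le> (log_kern D x y + ennreal e) * indicator {v..v + r} t" for t
            by (cases "t \<in> {v..v + r}") auto
          then show ?thesis by (intro mult_right_mono[OF nn_integral_mono]) auto
        qed simp
      qed
      also have "\<dots> = (log_kern D x y + ennreal e) * ennreal r * ennreal r"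
        by (simp only: int_r)
      also have "\<dots> = ennreal (r\<^sup>2) * (log_kern D x y + ennreal e)"
        using r by (simp add: power2_eq_square ennreal_mult) (simp only: mult_ac)
      also have "\<dots> \<le> ennreal (r\<^sup>2) * (ennreal (1 + th) * log_kern D x y + ennreal e)"
      proof (intro mult_left_mono add_right_mono)
        have "1 * log_kern D x y \<le> ennreal (1 + th) * log_kern D x y"
          using th by (intro mult_right_mono) (auto simp del: ennreal_plus)
        then show "log_kern D x y \<le> ennreal (1 + th) * log_kern D x y" by simp
      qed auto
      finally show ?thesis .
    next
      case False
      have kge: "ennreal (ln (D / (K * r))) \<le> log_kern D x y"
      proof (cases "x = y")
        case False
        have "D / (K * r) \<le> D / \<bar>x - y\<bar>"
          using \<open>\<not> K * r \<le> \<bar>x - y\<bar>\<close> False D by (intro divide_left_mono) (auto intro!: mult_pos_pos simp: r K)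
        then have "ln (D / (K * r)) \<le> ln (D / \<bar>x - y\<bar>)" using D r K by (intro ln_mono) auto
        then show ?thesis using False by (simp add: log_kern_def ennreal_leI)
      qed (simp add: log_kern_def)
      have "?L \<le> (\<integral>\<^sup>+ s. ennreal (r * (ln (D / r) + 4)) * indicator {u..u + r} s \<partial>lborel)"
        by (intro nn_integral_mono mult_right_mono nn_integral_log_kern_interval r) auto
      also have "\<dots> = ennreal (r * (ln (D / r) + 4)) * ennreal r" by (rule int_r)
      also have "\<dots> = ennreal (r\<^sup>2) * ennreal (ln (D / r) + 4)"
        using r by (simp add: ennreal_mult[symmetric] power2_eq_square mult_ac del: ennreal_plus)
      also have "\<dots> \<le> ennreal (r\<^sup>2) * ennreal ((1 + th) * ln (D / (K * r)))"
        by (intro mult_left_mono ennreal_leI W) auto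
      also have "\<dots> = ennreal (r\<^sup>2) * (ennreal (1 + th) * ennreal (ln (D / (K * r))))"
        using th lK by (subst ennreal_mult) auto
      also have "\<dots> \<le> ennreal (r\<^sup>2) * (ennreal (1 + th) * log_kern D x y)"
        by (intro mult_left_mono kge) auto
      also have "\<dots> \<le> ennreal (r\<^sup>2) * (ennreal (1 + th) * log_kern D x y + ennreal e)"
        by (intro mult_left_mono) auto
      finally show ?thesis .
    qed
  qed
  show ?thesis using r main by blast
qed

section \<open>Energies of smeared configurations\<close>

definition kern_energy :: "real \<Rightarrow> real measure \<Rightarrow> ennreal" where
  "kern_energy D \<nu> = (\<integral>\<^sup>+ x. \<integral>\<^sup>+ y. log_kern D x y \<partial>\<nu> \<partial>\<nu>)"

text \<open>For \<open>1 \<le> D\<close> bounding the diameter of \<open>E\<close>, this is the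
  Robin constant of \<open>E\<close> plus \<open>ln D\<close>.\<close>

definition kern_robin :: "real \<Rightarrow> real set \<Rightarrow> ennreal" where
  "kern_robin D E = (INF \<nu>\<in>prob_on E. kern_energy D \<nu>)"

lemma sum_symmetric_off_diagonal:
  fixes f :: "nat \<Rightarrow> nat \<Rightarrow> 'a::comm_monoid_add"
  assumes fin: "finite I" and sym: "\<And>i j. f i j = f j i"
  shows "(\<Sum>i\<in>I. \<Sum>j\<in>I - {i}. f i j) = (\<Sum>i\<in>I. \<Sum>j\<in>{j\<in>I. j < i}. f i j) + (\<Sum>i\<in>I. \<Sum>j\<in>{j\<in>I. j < i}. f i j)"
proof -
  have "(\<Sum>i\<in>I. \<Sum>j\<in>I - {i}. f i j) = (\<Sum>i\<in>I. (\<Sum>j\<in>{j\<in>I. j < i}. f i j) + (\<Sum>j\<in>{j\<in>I. i < j}. f i j))"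
  proof (intro sum.cong refl)
    fix i assume "i \<in> I"
    have "(\<Sum>j\<in>I - {i}. f i j) = (\<Sum>j\<in>{j\<in>I. j < i} \<union> {j\<in>I. i < j}. f i j)"
      by (rule sum.cong) auto
    also have "\<dots> = (\<Sum>j\<in>{j\<in>I. j < i}. f i j) + (\<Sum>j\<in>{j\<in>I. i < j}. f i j)"
      using fin by (intro sum.union_disjoint) auto
    finally show "(\<Sum>j\<in>I - {i}. f i j) = (\<Sum>j\<in>{j\<in>I. j < i}. f i j) + (\<Sum>j\<in>{j\<in>I. i < j}. f i j)" .
  qed
  also have "\<dots> = (\<Sum>i\<in>I. \<Sum>j\<in>{j\<in>I. j < i}. f i j) + (\<Sum>i\<in>I. \<Sum>j\<in>{j\<in>I. i < j}. f i j)"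
    by (rule sum.distrib)
  also have "(\<Sum>i\<in>I. \<Sum>j\<in>{j\<in>I. i < j}. f i j) = (\<Sum>j\<in>I. \<Sum>i\<in>{i\<in>I. i < j}. f i j)"
    using fin by (intro sum.swap_restrict)
  also have "\<dots> = (\<Sum>i\<in>I. \<Sum>j\<in>{j\<in>I. j < i}. f i j)"
    by (intro sum.cong refl sym)
  finally show ?thesis .
qed

lemma real_sum_lessThan_le: "real (\<Sum>i<N. i) \<le> (real N)\<^sup>2 / 2"
proof -
  have "2 * (\<Sum>i<N. i) \<le> N * N" by (induction N) auto
  then have "2 * real (\<Sum>i<N. i) \<le> real N * real N"
    by (metis of_nat_le_iff of_nat_mult of_nat_numeral)
  then show ?thesis by (simp add: power2_eq_square)
qed

text \<open>Each point becomes a uniform distribution of mass \<open>1 / N\<close> on its window.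
  Windows may overlap: \<open>N\<close> densities of height \<open>1 / (N * r)\<close> add up to at
  most \<open>1 / r\<close>. The double sum includes the self-energies \<open>i = j\<close>.\<close>

lemma exists_smeared_measure:
  assumes r: "0 < r" and N: "0 < N" and E: "E \<in> sets borel"
    and u: "\<And>i. i < N \<Longrightarrow> {u i..u i + r} \<subseteq> E"
  shows "\<exists>\<nu>\<in>prob_on E. (\<forall>A\<in>sets borel. emeasure \<nu> A \<le> ennreal (1 / r) * emeasure lborel A) \<and>
    kern_energy D \<nu> = (\<Sum>i<N. \<Sum>j<N. ennreal (1 / (real N * r)\<^sup>2) *
      (\<integral>\<^sup>+ s. (\<integral>\<^sup>+ t. log_kern D s t * indicator {u j..u j + r} t \<partial>lborel) * indicator {u i..u i + r} s \<partial>lborel))"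
proof -
  define k where "k = ennreal (1 / (real N * r))"
  define \<rho> where "\<rho> = (\<lambda>y. \<Sum>i<N. k * indicator {u i..u i + r} y)"
  have [measurable]: "\<rho> \<in> borel_measurable borel" unfolding \<rho>_def by measurable
  define \<nu> where "\<nu> = density lborel \<rho>"
  have s [measurable_cong]: "sets \<nu> = sets borel" by (simp add: \<nu>_def)
  have int: "(\<integral>\<^sup>+ y. f y \<partial>\<nu>) = (\<Sum>i<N. k * (\<integral>\<^sup>+ y. f y * indicator {u i..u i + r} y \<partial>lborel))"
    if [measurable]: "f \<in> borel_measurable borel" for f
  proof -
    have "(\<integral>\<^sup>+ y. f y \<partial>\<nu>) = (\<integral>\<^sup>+ y. \<rho> y * f y \<partial>lborel)"
      unfolding \<nu>_def by (intro nn_integral_density) auto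
    also have "\<dots> = (\<integral>\<^sup>+ y. (\<Sum>i<N. k * (f y * indicator {u i..u i + r} y)) \<partial>lborel)"
      unfolding \<rho>_def by (intro nn_integral_cong) (simp only: sum_distrib_right, simp only: mult_ac)
    also have "\<dots> = (\<Sum>i<N. \<integral>\<^sup>+ y. k * (f y * indicator {u i..u i + r} y) \<partial>lborel)"
      by (intro nn_integral_sum) auto
    also have "\<dots> = (\<Sum>i<N. k * (\<integral>\<^sup>+ y. f y * indicator {u i..u i + r} y \<partial>lborel))"
      by (intro sum.cong refl nn_integral_cmult) auto
    finally show ?thesis .
  qed
  have kr: "of_nat N * (k * ennreal r) = 1"
    using r N by (simp add: k_def ennreal_mult[symmetric] ennreal_of_nat_eq_real_of_nat)
  have em: "emeasure \<nu> A = (\<Sum>i<N. k * (\<integral>\<^sup>+ y. indicator A y * indicator {u i..u i + r} y \<partial>lborel))"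
    if A [measurable]: "A \<in> sets borel" for A
    using int[of "indicator A"] A by simp
  have "emeasure \<nu> UNIV = 1" using r kr by (subst em) auto
  then have P: "prob_space \<nu>" by (intro prob_spaceI) (simp add: \<nu>_def)
  have "emeasure \<nu> (UNIV - E) = 0"
  proof (subst em)
    have "(\<integral>\<^sup>+ y. indicator (UNIV - E) y * indicator {u i..u i + r} y \<partial>lborel) = 0" if "i < N" for i
    proof -
      have "(\<lambda>y. indicator (UNIV - E) y * indicator {u i..u i + r} y) = (\<lambda>_. 0 :: ennreal)"
        using u[OF that] by (intro ext) (auto simp: indicator_def)
      then show ?thesis by simp
    qed
    then show "(\<Sum>i<N. k * (\<integral>\<^sup>+ y. indicator (UNIV - E) y * indicator {u i..u i + r} y \<partial>lborel)) = 0"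
      by simp
  qed (use E in auto)
  then have nu: "\<nu> \<in> prob_on E" using P s by (simp add: prob_on_def)
  have dens: "emeasure \<nu> A \<le> ennreal (1 / r) * emeasure lborel A" if A [measurable]: "A \<in> sets borel" for A
  proof -
    have "emeasure \<nu> A \<le> (\<Sum>i<N. k * emeasure lborel A)"
    proof (subst em[OF A], intro sum_mono mult_left_mono)
      fix i
      have "(\<integral>\<^sup>+ y. indicator A y * indicator {u i..u i + r} y \<partial>lborel) \<le> (\<integral>\<^sup>+ y. indicator A y \<partial>lborel)"
        by (intro nn_integral_mono) (auto split: split_indicator)
      then show "(\<integral>\<^sup>+ y. indicator A y * indicator {u i..u i + r} y \<partial>lborel) \<le> emeasure lborel A" by simp
    qed auto
    also have "\<dots> = ennreal (1 / r) * emeasure lborel A"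
    proof -
      have "of_nat N * k = ennreal (1 / r)"
        using r N by (simp add: k_def ennreal_mult[symmetric] ennreal_of_nat_eq_real_of_nat)
      then show ?thesis by (simp add: mult.assoc[symmetric])
    qed
    finally show ?thesis .
  qed
  have "kern_energy D \<nu> = (\<Sum>i<N. k * (\<integral>\<^sup>+ s. (\<integral>\<^sup>+ t. log_kern D s t \<partial>\<nu>) * indicator {u i..u i + r} s \<partial>lborel))"
  proof -
    interpret prob_space \<nu> by (rule P)
    show ?thesis unfolding kern_energy_def by (rule int) measurable
  qed
  also have "\<dots> = (\<Sum>i<N. \<Sum>j<N. ennreal (1 / (real N * r)\<^sup>2) *
      (\<integral>\<^sup>+ s. (\<integral>\<^sup>+ t. log_kern D s t * indicator {u j..u j + r} t \<partial>lborel) * indicator {u i..u i + r} s \<partial>lborel))"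
  proof (intro sum.cong refl)
    fix i
    have "(\<integral>\<^sup>+ s. (\<integral>\<^sup>+ t. log_kern D s t \<partial>\<nu>) * indicator {u i..u i + r} s \<partial>lborel)
       = (\<integral>\<^sup>+ s. (\<Sum>j<N. k * ((\<integral>\<^sup>+ t. log_kern D s t * indicator {u j..u j + r} t \<partial>lborel) * indicator {u i..u i + r} s)) \<partial>lborel)"
      by (subst int, measurable) (simp only: sum_distrib_right, simp only: mult_ac)
    also have "\<dots> = (\<Sum>j<N. \<integral>\<^sup>+ s. k * ((\<integral>\<^sup>+ t. log_kern D s t * indicator {u j..u j + r} t \<partial>lborel) * indicator {u i..u i + r} s) \<partial>lborel)"
      by (intro nn_integral_sum) measurable
    also have "\<dots> = (\<Sum>j<N. k * (\<integral>\<^sup>+ s. (\<integral>\<^sup>+ t. log_kern D s t * indicator {u j..u j + r} t \<partial>lborel) * indicator {u i..u i + r} s \<partial>lborel))"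
      by (intro sum.cong refl nn_integral_cmult) measurable
    moreover have "k * k = ennreal (1 / (real N * r)\<^sup>2)"
      using r by (simp add: k_def ennreal_mult[symmetric] power2_eq_square)
    ultimately show "k * (\<integral>\<^sup>+ s. (\<integral>\<^sup>+ t. log_kern D s t \<partial>\<nu>) * indicator {u i..u i + r} s \<partial>lborel)
      = (\<Sum>j<N. ennreal (1 / (real N * r)\<^sup>2) *
      (\<integral>\<^sup>+ s. (\<integral>\<^sup>+ t. log_kern D s t * indicator {u j..u j + r} t \<partial>lborel) * indicator {u i..u i + r} s \<partial>lborel))"
      by (simp add: sum_distrib_left mult.assoc[symmetric])
  qed
  finally show ?thesis using nu dens by blast
qed

text \<open>This is the geometric input for smearing inside \<open>E\<close>. The window need not be
  centred at \<open>x\<close>, so that end points of intervals qualify.\<close>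

definition thick_at_scale :: "real \<Rightarrow> real set \<Rightarrow> bool" where
  "thick_at_scale r0 E \<longleftrightarrow> 0 < r0 \<and> (\<forall>x\<in>E. \<forall>r. 0 < r \<longrightarrow> r \<le> r0 \<longrightarrow>
     (\<exists>u. u \<le> x \<and> x \<le> u + r \<and> {u..u + r} \<subseteq> E))"

text \<open>Smearing makes the infinite self-interaction of a point finite, but the finite value
  depends on the window length \<open>r\<close>. There are only \<open>N\<close> such terms against
  about \<open>N^2\<close> pairs, so they become negligible when \<open>N\<close> grows with
  \<open>r\<close> fixed; this is why arbitrarily long tuples are assumed.\<close>

lemma exists_bounded_density_of_tuples:
  assumes thick: "thick_at_scale r0 E" and D: "0 < D" and c: "0 \<le> c" and E: "E \<in> sets borel"
    and tuples: "\<And>N0. \<exists>N\<ge>N0. \<exists>x. (\<forall>i<N. x i \<in> E) \<and>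
      (\<Sum>i<N. \<Sum>j<i. log_kern D (x i) (x j)) \<le> ennreal ((real N)\<^sup>2 / 2 * c)"
    and e: "0 < e"
  shows "\<exists>\<nu>\<in>prob_on E. \<exists>R>0. (\<forall>A\<in>sets borel. emeasure \<nu> A \<le> ennreal R * emeasure lborel A) \<and>
     kern_energy D \<nu> \<le> ennreal (c + e)"
proof -
  \<comment> \<open>The error \<open>e\<close> is spent in thirds: on the multiplicative error
    \<open>th * c\<close>, on the additive error of the averages, and on the self-energies. The
    \<open>+ 1\<close> allows \<open>c = 0\<close>.\<close>
  define th where "th = e / (3 * (c + 1))"
  have th: "0 < th" "th * c \<le> e / 3" using e c by (auto simp: th_def field_simps)
  have "0 < r0" using thick by (simp add: thick_at_scale_def)
  from log_kern_average_le[OF D, of "e / 3" th r0] e th this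
  obtain r where r: "0 < r" "r \<le> r0" "r \<le> D" and avg: "\<And>x y u v. u \<le> x \<Longrightarrow> x \<le> u + r \<Longrightarrow> v \<le> y \<Longrightarrow> y \<le> v + r \<Longrightarrow>
     (\<integral>\<^sup>+ s. (\<integral>\<^sup>+ t. log_kern D s t * indicator {v..v + r} t \<partial>lborel) * indicator {u..u + r} s \<partial>lborel)
       \<le> ennreal (r\<^sup>2) * (ennreal (1 + th) * log_kern D x y + ennreal (e / 3))" by auto
  define W where "W = ln (D / r) + 4"
  have W: "0 \<le> W" using r by (simp add: W_def)
  obtain N0 where N0: "3 * W / e \<le> real N0" using real_arch_simple by blast
  obtain N x where N: "max 1 N0 \<le> N" and x: "\<And>i. i < N \<Longrightarrow> x i \<in> E"
    and pairs: "(\<Sum>i<N. \<Sum>j<i. log_kern D (x i) (x j)) \<le> ennreal ((real N)\<^sup>2 / 2 * c)"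
    using tuples[of "max 1 N0"] by blast
  have N1: "0 < N" "3 * W / e \<le> real N" using N N0 by auto
  have "\<exists>u. u \<le> x i \<and> x i \<le> u + r \<and> {u..u + r} \<subseteq> E" if "i < N" for i
    using thick x[OF that] r by (auto simp: thick_at_scale_def)
  then obtain u where u: "\<And>i. i < N \<Longrightarrow> u i \<le> x i \<and> x i \<le> u i + r \<and> {u i..u i + r} \<subseteq> E" by metis
  define A where "A i j = (\<integral>\<^sup>+ s. (\<integral>\<^sup>+ t. log_kern D s t * indicator {u j..u j + r} t \<partial>lborel) * indicator {u i..u i + r} s \<partial>lborel)" for i j
  define B where "B i j = ennreal (1 + th) * log_kern D (x i) (x j) + ennreal (e / 3)" for i j
  from exists_smeared_measure[OF r(1) N1(1) E, of u D] u obtain \<nu> where nu: "\<nu> \<in> prob_on E"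
    and dens: "\<And>A. A\<in>sets borel \<Longrightarrow> emeasure \<nu> A \<le> ennreal (1 / r) * emeasure lborel A"
    and en: "kern_energy D \<nu> = (\<Sum>i<N. \<Sum>j<N. ennreal (1 / (real N * r)\<^sup>2) * A i j)"
    unfolding A_def by blast
  have AB: "A i j \<le> ennreal (r\<^sup>2) * B i j" if "i < N" "j < N" for i j
    unfolding A_def B_def using u that by (intro avg) auto
  \<comment> \<open>For the diagonal terms, where \<open>B i i\<close> is infinite and
    \<open>AB\<close> says nothing.\<close>
  have Aii: "A i j \<le> ennreal (r\<^sup>2) * ennreal W" for i j
  proof -
    have "A i j \<le> (\<integral>\<^sup>+ s. ennreal (r * W) * indicator {u i..u i + r} s \<partial>lborel)"
      unfolding A_def W_def by (intro nn_integral_mono mult_right_mono nn_integral_log_kern_interval r) auto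
    also have "\<dots> = ennreal (r * W) * ennreal r" using r by (subst nn_integral_cmult) auto
    also have "\<dots> = ennreal (r\<^sup>2) * ennreal W"
      using r W by (simp add: ennreal_mult[symmetric] power2_eq_square mult_ac)
    finally show ?thesis .
  qed
  have Bsym: "B i j = B j i" for i j by (simp add: B_def log_kern_commute)
  have T: "(\<Sum>i<N. \<Sum>j\<in>{j\<in>{..<N}. j < i}. B i j) \<le> ennreal ((real N)\<^sup>2 / 2 * (c + 2 * e / 3))" (is "?T \<le> _")
  proof -
    have "?T = (\<Sum>i<N. \<Sum>j<i. B i j)" by (intro sum.cong) auto
    also have "\<dots> = ennreal (1 + th) * (\<Sum>i<N. \<Sum>j<i. log_kern D (x i) (x j)) + of_nat (\<Sum>i<N. i) * ennreal (e / 3)"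
      by (simp add: B_def sum.distrib sum_distrib_left sum_distrib_right)
    also have "\<dots> \<le> ennreal (1 + th) * ennreal ((real N)\<^sup>2 / 2 * c) + ennreal ((real N)\<^sup>2 / 2) * ennreal (e / 3)"
      using real_sum_lessThan_le[of N] pairs by (intro add_mono mult_left_mono mult_right_mono)
        (simp_all only: ennreal_of_nat_eq_real_of_nat ennreal_leI zero_le)
    also have "\<dots> = ennreal ((1 + th) * ((real N)\<^sup>2 / 2 * c) + (real N)\<^sup>2 / 2 * (e / 3))"
      using th c e by (simp add: ennreal_mult[symmetric] ennreal_plus[symmetric] del: ennreal_plus)
    also have "\<dots> \<le> ennreal ((real N)\<^sup>2 / 2 * (c + 2 * e / 3))"
    proof (rule ennreal_leI)
      have "(real N)\<^sup>2 / 2 * (th * c) \<le> (real N)\<^sup>2 / 2 * (e / 3)"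
        using th by (intro mult_left_mono) auto
      moreover have "X * (th * c) \<le> X * (e / 3) \<Longrightarrow> (1 + th) * (X * c) + X * (e / 3) \<le> X * (c + 2 * e / 3)" for X
        by (simp add: algebra_simps)
      ultimately show "(1 + th) * ((real N)\<^sup>2 / 2 * c) + (real N)\<^sup>2 / 2 * (e / 3) \<le> (real N)\<^sup>2 / 2 * (c + 2 * e / 3)"
        by blast
    qed
    finally show ?thesis .
  qed
  have "(\<Sum>i<N. \<Sum>j<N. A i j) \<le> (\<Sum>i<N. ennreal (r\<^sup>2) * ennreal W + (\<Sum>j\<in>{..<N} - {i}. ennreal (r\<^sup>2) * B i j))"
  proof (rule sum_mono)
    fix i assume i: "i \<in> {..<N}"
    have "(\<Sum>j<N. A i j) = A i i + (\<Sum>j\<in>{..<N} - {i}. A i j)" using i by (simp add: sum.remove)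
    also have "\<dots> \<le> ennreal (r\<^sup>2) * ennreal W + (\<Sum>j\<in>{..<N} - {i}. ennreal (r\<^sup>2) * B i j)"
      using i by (intro add_mono Aii sum_mono AB) auto
    finally show "(\<Sum>j<N. A i j) \<le> ennreal (r\<^sup>2) * ennreal W + (\<Sum>j\<in>{..<N} - {i}. ennreal (r\<^sup>2) * B i j)" .
  qed
  also have "\<dots> = ennreal (r\<^sup>2) * (of_nat N * ennreal W + (\<Sum>i<N. \<Sum>j\<in>{..<N} - {i}. B i j))"
    by (simp add: sum.distrib sum_distrib_left distrib_left mult_ac)
  also have "(\<Sum>i<N. \<Sum>j\<in>{..<N} - {i}. B i j) \<le> ennreal ((real N)\<^sup>2 / 2 * (c + 2 * e / 3)) + ennreal ((real N)\<^sup>2 / 2 * (c + 2 * e / 3))"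
    unfolding sum_symmetric_off_diagonal[of "{..<N}" B, OF finite_lessThan Bsym] by (intro add_mono T)
  also have "of_nat N * ennreal W + (ennreal ((real N)\<^sup>2 / 2 * (c + 2 * e / 3)) + ennreal ((real N)\<^sup>2 / 2 * (c + 2 * e / 3)))
     = ennreal (real N * W + (real N)\<^sup>2 * (c + 2 * e / 3))"
    using W c e by (simp add: ennreal_of_nat_eq_real_of_nat ennreal_mult[symmetric] ennreal_plus[symmetric] del: ennreal_plus)
  also have "\<dots> \<le> ennreal ((real N)\<^sup>2 * (c + e))"
  proof (rule ennreal_leI)
    have "W \<le> real N * (e / 3)" using N1 e by (simp add: field_simps)
    then have "real N * W \<le> real N * (real N * (e / 3))" by (intro mult_left_mono) auto
    then show "real N * W + (real N)\<^sup>2 * (c + 2 * e / 3) \<le> (real N)\<^sup>2 * (c + e)"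
      by (simp add: algebra_simps power2_eq_square)
  qed
  finally have sumA: "(\<Sum>i<N. \<Sum>j<N. A i j) \<le> ennreal (r\<^sup>2) * ennreal ((real N)\<^sup>2 * (c + e))"
    by (simp add: mult_left_mono)
  have "kern_energy D \<nu> = ennreal (1 / (real N * r)\<^sup>2) * (\<Sum>i<N. \<Sum>j<N. A i j)"
    by (simp add: en sum_distrib_left)
  also have "\<dots> \<le> ennreal (1 / (real N * r)\<^sup>2) * (ennreal (r\<^sup>2) * ennreal ((real N)\<^sup>2 * (c + e)))"
    by (intro mult_left_mono sumA) auto
  also have "\<dots> = ennreal (1 / (real N * r)\<^sup>2 * (r\<^sup>2 * ((real N)\<^sup>2 * (c + e))))"
    using c e by (simp add: ennreal_mult[symmetric] del: ennreal_plus)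
  also have "1 / (real N * r)\<^sup>2 * (r\<^sup>2 * ((real N)\<^sup>2 * (c + e))) = c + e"
    using N1 r by (simp add: power_mult_distrib field_simps)
  finally have "kern_energy D \<nu> \<le> ennreal (c + e)" .
  moreover have "0 < 1 / r" using r by simp
  ultimately show ?thesis using nu dens by blast
qed

lemma kern_robin_finite:
  assumes thick: "thick_at_scale r0 E" and D: "0 < D" and E: "E \<in> sets borel" and ne: "E \<noteq> {}"
  shows "kern_robin D E < \<infinity>"
proof -
  define r where "r = min r0 D"
  have r: "0 < r" "r \<le> r0" "r \<le> D" using thick D by (auto simp: r_def thick_at_scale_def)
  obtain x where "x \<in> E" using ne by auto
  then obtain u where u: "{u..u + r} \<subseteq> E" using thick r unfolding thick_at_scale_def by blast
  from exists_smeared_measure[OF r(1) _ E, of 1 "\<lambda>_. u" D] u obtain \<nu> where nu: "\<nu> \<in> prob_on E"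
    and en: "kern_energy D \<nu> = ennreal (1 / r\<^sup>2) *
      (\<integral>\<^sup>+ s. (\<integral>\<^sup>+ t. log_kern D s t * indicator {u..u + r} t \<partial>lborel) * indicator {u..u + r} s \<partial>lborel)"
    by auto
  have "kern_energy D \<nu> \<le> ennreal (1 / r\<^sup>2) * (\<integral>\<^sup>+ s. ennreal (r * (ln (D / r) + 4)) * indicator {u..u + r} s \<partial>lborel)"
    unfolding en by (intro nn_integral_mono mult_right_mono mult_left_mono nn_integral_log_kern_interval r) auto
  also have "\<dots> = ennreal (1 / r\<^sup>2) * (ennreal (r * (ln (D / r) + 4)) * ennreal r)"
    using r by (subst nn_integral_cmult) auto
  also have "\<dots> < \<infinity>" by (simp add: ennreal_mult_less_top)
  finally show ?thesis unfolding kern_robin_def using nu by (meson INF_lower le_less_trans)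
qed

section \<open>Capacity and Leja points\<close>

text \<open>The pointwise identity \<open>pw\<close> is a sum of nonnegative terms, so it can be
  integrated without any finiteness. Only afterwards is the integral of \<open>logk_neg\<close>
  subtracted, which is legitimate because that kernel is bounded by \<open>ln D\<close> on
  \<open>E\<close>; the other two integrals may both be infinite.\<close>

lemma log_energy_eq_kern_energy:
  assumes nu: "\<nu> \<in> prob_on E" and E: "E \<in> sets borel" and D: "1 \<le> D"
    and diam: "\<And>x y. x \<in> E \<Longrightarrow> y \<in> E \<Longrightarrow> \<bar>x - y\<bar> \<le> D"
  shows "log_energy \<nu> = enn2ereal (kern_energy D \<nu>) - ereal (ln D)"
proof -
  interpret prob_space \<nu> using nu by (simp add: prob_on_def)
  have s [measurable_cong]: "sets \<nu> = sets borel" using nu by (simp add: prob_on_def)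
  have "UNIV - E \<in> null_sets \<nu>"
    using nu E s by (auto simp: prob_on_def null_sets_def)
  then have AE: "AE x in \<nu>. x \<in> E" by (rule AE_I') auto
  have [measurable]: "(\<lambda>(x, y). logk_pos x y) \<in> borel_measurable (borel \<Otimes>\<^sub>M borel)"
    unfolding logk_pos_def by measurable
  have [measurable]: "(\<lambda>(x, y). logk_neg x y) \<in> borel_measurable (borel \<Otimes>\<^sub>M borel)"
    unfolding logk_neg_def by measurable
  have pw: "log_kern D x y + logk_neg x y = ennreal (ln D) + logk_pos x y" if "x \<in> E" "y \<in> E" for x y
  proof (cases "x = y")
    case False
    define t where "t = \<bar>x - y\<bar>"
    have t: "0 < t" "t \<le> D" using False diam that by (auto simp: t_def)
    have l: "ln (D / t) = ln D - ln t" "ln (1 / t) = - ln t" using t D by (simp_all add: ln_div)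
    have "0 \<le> ln D" "ln t \<le> ln D" using t D by simp_all
    then have "ennreal (ln (D / t)) + ennreal (ln t) = ennreal (ln D) + ennreal (ln (1 / t))"
      by (cases "0 \<le> ln t") (simp_all add: l ennreal_neg ennreal_plus[symmetric] del: ennreal_plus)
    then show ?thesis using False by (simp add: log_kern_def logk_neg_def logk_pos_def t_def)
  qed (simp add: log_kern_def logk_pos_def)
  define P where "P = (\<integral>\<^sup>+ x. \<integral>\<^sup>+ y. logk_pos x y \<partial>\<nu> \<partial>\<nu>)"
  define M where "M = (\<integral>\<^sup>+ x. \<integral>\<^sup>+ y. logk_neg x y \<partial>\<nu> \<partial>\<nu>)"
  have "kern_energy D \<nu> + M = (\<integral>\<^sup>+ x. (\<integral>\<^sup>+ y. log_kern D x y \<partial>\<nu>) + (\<integral>\<^sup>+ y. logk_neg x y \<partial>\<nu>) \<partial>\<nu>)"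
    unfolding kern_energy_def M_def by (rule nn_integral_add[symmetric]) measurable
  also have "\<dots> = (\<integral>\<^sup>+ x. ennreal (ln D) + (\<integral>\<^sup>+ y. logk_pos x y \<partial>\<nu>) \<partial>\<nu>)"
  proof (rule nn_integral_cong_AE, rule eventually_mono[OF AE])
    fix x assume x: "x \<in> E"
    have "(\<integral>\<^sup>+ y. log_kern D x y \<partial>\<nu>) + (\<integral>\<^sup>+ y. logk_neg x y \<partial>\<nu>) = (\<integral>\<^sup>+ y. log_kern D x y + logk_neg x y \<partial>\<nu>)"
      by (rule nn_integral_add[symmetric]) measurable
    also have "\<dots> = (\<integral>\<^sup>+ y. ennreal (ln D) + logk_pos x y \<partial>\<nu>)"
      by (rule nn_integral_cong_AE, rule eventually_mono[OF AE]) (rule pw[OF x])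
    also have "\<dots> = ennreal (ln D) + (\<integral>\<^sup>+ y. logk_pos x y \<partial>\<nu>)"
      by (subst nn_integral_add) (auto simp: emeasure_space_1)
    finally show "(\<integral>\<^sup>+ y. log_kern D x y \<partial>\<nu>) + (\<integral>\<^sup>+ y. logk_neg x y \<partial>\<nu>) = ennreal (ln D) + (\<integral>\<^sup>+ y. logk_pos x y \<partial>\<nu>)" .
  qed
  also have "\<dots> = ennreal (ln D) + P"
    unfolding P_def by (subst nn_integral_add) (auto simp: emeasure_space_1)
  finally have eq: "kern_energy D \<nu> + M = ennreal (ln D) + P" .
  have "M \<le> (\<integral>\<^sup>+ x. \<integral>\<^sup>+ y. ennreal (ln D) \<partial>\<nu> \<partial>\<nu>)" unfolding M_def
  proof (rule nn_integral_mono_AE, rule eventually_mono[OF AE], rule nn_integral_mono_AE, rule eventually_mono[OF AE])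
    fix x y assume xy: "x \<in> E" "y \<in> E"
    \<comment> \<open>On the diagonal this rests on the convention \<open>ln 0 = 0\<close>.\<close>
    have "ln \<bar>x - y\<bar> \<le> ln D"
      using diam[OF xy] D by (cases "x = y") auto
    then show "logk_neg x y \<le> ennreal (ln D)" by (simp add: logk_neg_def ennreal_leI)
  qed
  then have "M < top" by (simp add: emeasure_space_1) (meson ennreal_less_top le_less_trans)
  then obtain m where m: "M = ennreal m" "0 \<le> m" by (cases M) auto
  have lD: "0 \<le> ln D" using D by simp
  have "enn2ereal P - enn2ereal M = enn2ereal (kern_energy D \<nu>) - ereal (ln D)"
  proof (cases P)
    case (real p)
    then have "kern_energy D \<nu> + ennreal m = ennreal (ln D + p)" using eq m lD by (simp add: ennreal_plus)
    moreover from this obtain k where k: "kern_energy D \<nu> = ennreal k" "0 \<le> k"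
      by (cases "kern_energy D \<nu>") auto
    ultimately have "k + m = ln D + p" using m real lD
      by (metis add_nonneg_nonneg ennreal_inj ennreal_plus)
    then show ?thesis using real m k by simp
  next
    case top
    then have "kern_energy D \<nu> = top" using eq m by (cases "kern_energy D \<nu>") (auto simp: ennreal_plus[symmetric] simp del: ennreal_plus)
    then show ?thesis using top m by simp
  qed
  then show ?thesis by (simp add: log_energy_def P_def M_def)
qed

text \<open>The factor \<open>D\<close> undoes the shift of the kernel. Finiteness of
  \<open>J\<close> selects the exponential branch in the definition of capacity.\<close>

lemma log_capacity_eq_exp_kern_robin:
  assumes E: "E \<in> sets borel" and D: "1 \<le> D"
    and diam: "\<And>x y. x \<in> E \<Longrightarrow> y \<in> E \<Longrightarrow> \<bar>x - y\<bar> \<le> D"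
    and fin: "kern_robin D E = ennreal J" and J: "0 \<le> J"
  shows "log_capacity E = D * exp (- J)"
proof -
  define I where "I = (INF \<nu>\<in>prob_on E. log_energy \<nu>)"
  have le: "log_energy \<nu> = enn2ereal (kern_energy D \<nu>) - ereal (ln D)" if "\<nu> \<in> prob_on E" for \<nu>
    using log_energy_eq_kern_energy[OF that E D diam] by blast
  have "I = ereal (J - ln D)"
  proof (rule antisym)
    show "I \<le> ereal (J - ln D)"
    proof (rule ereal_le_epsilon2)
      fix e :: real assume e: "0 < e"
      have "kern_robin D E < ennreal (J + e)" using fin J e by (simp add: ennreal_less_iff del: ennreal_plus)
      then obtain \<nu> where nu: "\<nu> \<in> prob_on E" "kern_energy D \<nu> < ennreal (J + e)"
        by (auto simp: kern_robin_def INF_less_iff simp del: ennreal_plus)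
      then obtain k where k: "kern_energy D \<nu> = ennreal k" "0 \<le> k" by (cases "kern_energy D \<nu>") auto
      have "k < J + e" using nu k J e by (simp add: ennreal_less_iff del: ennreal_plus)
      moreover have "I \<le> log_energy \<nu>" unfolding I_def using nu by (intro INF_lower)
      moreover have "log_energy \<nu> = ereal (k - ln D)" using le[OF nu(1)] k by simp
      ultimately show "I \<le> ereal (J - ln D) + ereal e"
        by (simp add: order_trans[of I "ereal (k - ln D)"])
    qed
    show "ereal (J - ln D) \<le> I" unfolding I_def
    proof (rule INF_greatest)
      fix \<nu> assume nu: "\<nu> \<in> prob_on E"
      have "ennreal J \<le> kern_energy D \<nu>" using nu fin by (metis INF_lower kern_robin_def)
      then have "ereal J \<le> enn2ereal (kern_energy D \<nu>)" using J
        by (metis enn2ereal_ennreal less_eq_ennreal.rep_eq)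
      then show "ereal (J - ln D) \<le> log_energy \<nu>" unfolding le[OF nu]
        using ereal_minus_mono[of "ereal J" "enn2ereal (kern_energy D \<nu>)" "ereal (ln D)" "ereal (ln D)"] by simp
    qed
  qed
  then have "log_capacity E = exp (- (J - ln D))"
    unfolding log_capacity_def I_def prob_on_def Let_def by simp
  also have "\<dots> = D * exp (- J)" using D by (simp add: exp_diff exp_minus field_simps)
  finally show ?thesis .
qed

text \<open>These are Leja points. The choice of a point depends on all earlier ones, so the
  recursion runs over the list of points chosen so far.\<close>

lemma exists_greedy_points:
  fixes E :: "real set"
  assumes "compact E" "E \<noteq> {}"
  shows "\<exists>x :: nat \<Rightarrow> real. \<forall>i. x i \<in> E \<and> (\<forall>z\<in>E. \<bar>\<Prod>j<i. z - x j\<bar> \<le> \<bar>\<Prod>j<i. x i - x j\<bar>)"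
proof -
  have "\<exists>r. r \<in> E \<and> (\<forall>z\<in>E. \<bar>\<Prod>y\<leftarrow>ys. z - y\<bar> \<le> \<bar>\<Prod>y\<leftarrow>ys. r - y\<bar>)" for ys
  proof -
    have "continuous_on E (\<lambda>z. \<Prod>y\<leftarrow>ys. z - y)" by (induction ys) (auto intro!: continuous_intros)
    then have "continuous_on E (\<lambda>z. \<bar>\<Prod>y\<leftarrow>ys. z - y\<bar>)" by (intro continuous_intros)
    from continuous_attains_sup[OF assms this] show ?thesis by blast
  qed
  then obtain pick where pick: "\<And>ys. pick ys \<in> E"
    "\<And>ys z. z \<in> E \<Longrightarrow> \<bar>\<Prod>y\<leftarrow>ys. z - y\<bar> \<le> \<bar>\<Prod>y\<leftarrow>ys. pick ys - y\<bar>" by metis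
  define L where "L = rec_nat [] (\<lambda>_ ys. pick ys # ys)"
  have "(\<Prod>j<i. z - pick (L j)) = (\<Prod>y\<leftarrow>L i. z - y)" for i z
    by (induction i) (auto simp: L_def)
  then have "\<forall>i. pick (L i) \<in> E \<and> (\<forall>z\<in>E. \<bar>\<Prod>j<i. z - pick (L j)\<bar> \<le> \<bar>\<Prod>j<i. pick (L i) - pick (L j)\<bar>)"
    using pick by simp
  then show ?thesis by (rule exI[where P = "\<lambda>x. \<forall>i. x i \<in> E \<and> (\<forall>z\<in>E. \<bar>\<Prod>j<i. z - x j\<bar> \<le> \<bar>\<Prod>j<i. x i - x j\<bar>)"])
qed

lemma monic_prod_linear:
  fixes x :: "'b \<Rightarrow> real"
  assumes "finite A"
  shows "lead_coeff (\<Prod>j\<in>A. [:- x j, 1:]) = 1" "degree (\<Prod>j\<in>A. [:- x j, 1:]) = card A"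
    "poly (\<Prod>j\<in>A. [:- x j, 1:]) z = (\<Prod>j\<in>A. z - x j)"
proof -
  show "lead_coeff (\<Prod>j\<in>A. [:- x j, 1:]) = 1" by (simp add: lead_coeff_prod)
  show "degree (\<Prod>j\<in>A. [:- x j, 1:]) = card A"
    using degree_prod_eq_sum_degree[of A "\<lambda>j. [:- x j, 1:]"] by simp
  show "poly (\<Prod>j\<in>A. [:- x j, 1:]) z = (\<Prod>j\<in>A. z - x j)" by (simp add: poly_prod)
qed

lemma exists_monic_small_on:
  assumes thick: "thick_at_scale r0 E" and E: "compact E" "E \<noteq> {}" and D: "1 \<le> D"
    and diam: "\<And>x y. x \<in> E \<Longrightarrow> y \<in> E \<Longrightarrow> \<bar>x - y\<bar> \<le> D"
    and c: "log_capacity E < c"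
  shows "\<exists>T :: real poly. lead_coeff T = 1 \<and> 0 < degree T \<and> (\<forall>x\<in>E. \<bar>poly T x\<bar> \<le> c ^ degree T)"
proof (rule ccontr)
  assume neg: "\<not> ?thesis"
  have Eb: "E \<in> sets borel" using E by (simp add: borel_compact)
  have "kern_robin D E < \<infinity>" using kern_robin_finite[OF thick _ Eb E(2)] D by simp
  then obtain J where J: "kern_robin D E = ennreal J" "0 \<le> J" by (cases "kern_robin D E") auto
  have c': "D * exp (- J) < c" using log_capacity_eq_exp_kern_robin[OF Eb D diam J] c by simp
  have c0: "0 < c" using c' D by (smt (verit) exp_gt_zero mult_pos_pos)
  \<comment> \<open>Otherwise the linear polynomial with a zero in \<open>E\<close> is already small
    enough. The bound makes \<open>b\<close> positive.\<close>
  have cD: "c < D"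
  proof (rule ccontr)
    assume "\<not> c < D"
    obtain a where "a \<in> E" using E by auto
    then have "\<forall>x\<in>E. \<bar>poly [:- a, 1:] x\<bar> \<le> c ^ degree [:- a, 1:]"
      using diam[of _ a] \<open>\<not> c < D\<close> by fastforce
    moreover have "lead_coeff [:- a, 1:] = 1" "0 < degree [:- a, 1:]" by simp_all
    ultimately show False using neg by blast
  qed
  define b where "b = ln (D / c)"
  have b: "0 < b" "b < J"
  proof -
    show "0 < b" using cD c0 by (simp add: b_def)
    have "ln (D * exp (- J)) < ln c" using c' D by (subst ln_less_cancel_iff) (auto simp: c0)
    then show "b < J" using D c0 by (simp add: b_def ln_div ln_mult)
  qed
  from exists_greedy_points[OF E] obtain x :: "nat \<Rightarrow> real"
    where x: "\<forall>i. x i \<in> E \<and> (\<forall>z\<in>E. \<bar>\<Prod>j<i. z - x j\<bar> \<le> \<bar>\<Prod>j<i. x i - x j\<bar>)" ..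
  have xE: "x i \<in> E" for i using x by simp
  have xmax: "\<bar>\<Prod>j<i. z - x j\<bar> \<le> \<bar>\<Prod>j<i. x i - x j\<bar>" if "z \<in> E" for i z using x that by simp
  \<comment> \<open>The monic polynomial with the earlier points as zeros exceeds
    \<open>c ^ i\<close> somewhere on \<open>E\<close>, hence at its maximum point
    \<open>x i\<close>. The points are therefore distinct and, per pair, the shifted kernel is at
    most \<open>b = ln (D / c)\<close> on average.\<close>
  have big: "c ^ i < \<bar>\<Prod>j<i. x i - x j\<bar>" if i: "0 < i" for i
  proof -
    define T where "T = (\<Prod>j<i. [:- x j, 1:])"
    have "lead_coeff T = 1" "degree T = card {..<i}" "\<And>z. poly T z = (\<Prod>j<i. z - x j)"
      unfolding T_def by (rule monic_prod_linear, simp)+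
    then have "\<not> (\<forall>z\<in>E. \<bar>\<Prod>j<i. z - x j\<bar> \<le> c ^ i)"
      using neg i by (metis card_lessThan)
    then obtain z where "z \<in> E" "c ^ i < \<bar>\<Prod>j<i. z - x j\<bar>" by (auto simp: not_le)
    then show ?thesis using xmax[of z i] by simp
  qed
  have row: "(\<Sum>j<i. log_kern D (x i) (x j)) \<le> ennreal (real i * b)" for i
  proof (cases "i = 0")
    case False
    have "0 < c ^ i" using c0 by simp
    then have "0 < \<bar>\<Prod>j<i. x i - x j\<bar>" using less_trans[OF _ big[of i]] False by blast
    then have "(\<Prod>j<i. x i - x j) \<noteq> 0" using zero_less_abs_iff by blast
    then have "\<forall>j\<in>{..<i}. x i - x j \<noteq> 0" by simp
    then have ne: "x i \<noteq> x j" if "j < i" for j using that by auto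
    have "(\<Sum>j<i. log_kern D (x i) (x j)) = (\<Sum>j<i. ennreal (ln D - ln \<bar>x i - x j\<bar>))"
      using ne D by (intro sum.cong) (auto simp: log_kern_def ln_div)
    also have "\<dots> = ennreal (\<Sum>j<i. ln D - ln \<bar>x i - x j\<bar>)"
      using diam[OF xE xE] ne D by (intro sum_ennreal) auto
    also have "(\<Sum>j<i. ln D - ln \<bar>x i - x j\<bar>) = real i * ln D - ln (\<Prod>j<i. \<bar>x i - x j\<bar>)"
      using ne by (subst ln_prod) (auto simp: sum_subtractf)
    also have "\<dots> \<le> real i * b"
    proof -
      have "ln (c ^ i) \<le> ln (\<Prod>j<i. \<bar>x i - x j\<bar>)"
        using big[of i] False \<open>0 < c ^ i\<close> unfolding abs_prod by (intro ln_mono) auto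
      then show ?thesis using c0 D by (simp add: b_def ln_div ln_realpow algebra_simps)
    qed
    finally show ?thesis by (simp add: ennreal_leI)
  qed simp
  have tup: "\<exists>N\<ge>N0. \<exists>x. (\<forall>i<N. x i \<in> E) \<and> (\<Sum>i<N. \<Sum>j<i. log_kern D (x i) (x j)) \<le> ennreal ((real N)\<^sup>2 / 2 * b)" for N0
  proof (intro exI[of _ N0] conjI exI[of _ x])
    have "(\<Sum>i<N0. \<Sum>j<i. log_kern D (x i) (x j)) \<le> (\<Sum>i<N0. ennreal (real i * b))"
      by (intro sum_mono row)
    also have "\<dots> = ennreal (real (\<Sum>i<N0. i) * b)" using b
      by (subst sum_ennreal) (auto simp: sum_distrib_right)
    also have "\<dots> \<le> ennreal ((real N0)\<^sup>2 / 2 * b)"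
      using b by (intro ennreal_leI mult_right_mono real_sum_lessThan_le) auto
    finally show "(\<Sum>i<N0. \<Sum>j<i. log_kern D (x i) (x j)) \<le> ennreal ((real N0)\<^sup>2 / 2 * b)" .
  qed (use xE in auto)
  \<comment> \<open>Half of the gap between \<open>b\<close> and \<open>J\<close> may be lost in
    smearing, and the energy still falls below the minimum \<open>J\<close>.\<close>
  have "0 < D" "0 \<le> b" "0 < (J - b) / 2" using D b by auto
  from exists_bounded_density_of_tuples[OF thick this(1,2) Eb tup this(3)]
  obtain \<nu> where nu: "\<nu> \<in> prob_on E" "kern_energy D \<nu> \<le> ennreal (b + (J - b) / 2)" by blast
  have "ennreal J \<le> kern_energy D \<nu>" using nu J by (metis INF_lower kern_robin_def)
  then have "ennreal J \<le> ennreal (b + (J - b) / 2)" using nu by (meson order_trans)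
  then have "J \<le> b + (J - b) / 2" using b by (subst (asm) ennreal_le_iff) auto
  then show False using b by (simp add: field_simps)
qed

section \<open>Vandermonde products\<close>

text \<open>Compare leading coefficients in Lagrange interpolation: \<open>Q\<close> minus its
  interpolant has more zeros than its degree permits and vanishes, and each numerator
  \<open>L i\<close> is monic of the degree of \<open>Q\<close>.\<close>

lemma lagrange_leading_coefficient:
  fixes y :: "'b \<Rightarrow> real"
  assumes fin: "finite I" and inj: "inj_on y I" and deg: "Suc (degree Q) = card I"
  shows "(\<Sum>i\<in>I. poly Q (y i) / (\<Prod>j\<in>I - {i}. y i - y j)) = lead_coeff Q"
proof -
  define w where "w i = (\<Prod>j\<in>I - {i}. y i - y j)" for i
  define L where "L i = (\<Prod>j\<in>I - {i}. [:- y j, 1:])" for i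
  have cardI: "card (I - {i}) = degree Q" if "i \<in> I" for i using that fin deg by simp
  have L: "poly (L i) z = (\<Prod>j\<in>I - {i}. z - y j)" "degree (L i) = card (I - {i})" "lead_coeff (L i) = 1" for i z
    unfolding L_def by (rule monic_prod_linear, use fin in simp)+
  have w: "w i \<noteq> 0" if "i \<in> I" for i
    using that fin inj by (auto simp: w_def prod_zero_iff inj_on_def)
  define R where "R = Q - (\<Sum>i\<in>I. smult (poly Q (y i) / w i) (L i))"
  have zero: "poly R (y k) = 0" if k: "k \<in> I" for k
  proof -
    have "(\<Sum>i\<in>I. poly Q (y i) / w i * poly (L i) (y k)) = (\<Sum>i\<in>I. if i = k then poly Q (y k) else 0)"
    proof (intro sum.cong refl)
      fix i assume i: "i \<in> I"
      show "poly Q (y i) / w i * poly (L i) (y k) = (if i = k then poly Q (y k) else 0)"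
      proof (cases "i = k")
        case True
        then show ?thesis using w[OF i] by (simp add: L(1) w_def[symmetric])
      next
        case False
        then have "k \<in> I - {i}" using k by simp
        then have "poly (L i) (y k) = 0" using fin by (auto simp: L(1) prod_zero_iff)
        then show ?thesis using False by simp
      qed
    qed
    then show ?thesis using k fin by (simp add: R_def poly_sum)
  qed
  have "degree R \<le> degree Q" unfolding R_def
    by (intro degree_diff_le order_refl degree_sum_le fin order_trans[OF degree_smult_le]) (use deg fin in \<open>simp add: L(2)\<close>)
  moreover have "card I \<le> card {x. poly R x = 0}" if "R \<noteq> 0"
  proof -
    have "y ` I \<subseteq> {x. poly R x = 0}" using zero by auto
    then have "card (y ` I) \<le> card {x. poly R x = 0}" using poly_roots_finite[OF that] by (intro card_mono)
    then show ?thesis using card_image[OF inj] by simp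
  qed
  ultimately have "R = 0" using card_poly_roots_bound[of R] deg by fastforce
  then have "Q = (\<Sum>i\<in>I. smult (poly Q (y i) / w i) (L i))" by (simp add: R_def)
  then have "coeff Q (degree Q) = coeff (\<Sum>i\<in>I. smult (poly Q (y i) / w i) (L i)) (degree Q)" by simp
  also have "\<dots> = (\<Sum>i\<in>I. poly Q (y i) / w i * coeff (L i) (degree Q))" by (simp add: coeff_sum)
  also have "\<dots> = (\<Sum>i\<in>I. poly Q (y i) / w i)"
  proof (intro sum.cong refl)
    fix i assume "i \<in> I"
    then have "coeff (L i) (degree Q) = 1" using L(3)[of i] unfolding L(2) cardI[OF \<open>i \<in> I\<close>] by blast
    then show "poly Q (y i) / w i * coeff (L i) (degree Q) = poly Q (y i) / w i" by simp
  qed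
  finally show ?thesis by (simp add: w_def)
qed

text \<open>By Lagrange's formula the coefficients \<open>1 / w i\<close> cannot all be small, so there is a point whose
  product \<open>w i\<close> of distances to the others is small enough; it is removed and the rest is left to induction.\<close>

lemma vandermonde_bound:
  fixes y :: "'b \<Rightarrow> real" and Q :: "nat \<Rightarrow> real poly" and B :: "nat \<Rightarrow> real"
  assumes fin: "finite I" and inj: "inj_on y I"
    and Q: "\<And>j. j < card I \<Longrightarrow> lead_coeff (Q j) = 1 \<and> degree (Q j) = j"
    and B: "\<And>i j. i \<in> I \<Longrightarrow> j < card I \<Longrightarrow> \<bar>poly (Q j) (y i)\<bar> \<le> B j"
  shows "(\<Sum>i\<in>I. \<Sum>j\<in>I - {i}. ln \<bar>y i - y j\<bar>) \<le> 2 * (\<Sum>j<card I. ln (real (j + 1) * B j))"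
  using fin inj Q B
proof (induction "card I" arbitrary: I)
  case 0
  then show ?case by simp
next
  case (Suc q)
  note fin = Suc.prems(1) and inj = Suc.prems(2)
  have q: "card I = Suc q" using Suc by simp
  define w where "w i = (\<Prod>j\<in>I - {i}. y i - y j)" for i
  have w: "w i \<noteq> 0" if "i \<in> I" for i
    using that fin inj by (auto simp: w_def prod_zero_iff inj_on_def)
  have ne: "I \<noteq> {}" using q by auto
  have Qq: "lead_coeff (Q q) = 1" "degree (Q q) = q" using Suc.prems(3)[of q] q by auto
  \<comment> \<open>The \<open>q + 1\<close> terms of Lagrange's formula for the monic
    \<open>Q q\<close> add up to 1, so one of them has modulus at least \<open>1 / (q + 1)\<close>.
    This is the source of the factor \<open>j + 1\<close> in the bound.\<close>
  have "\<exists>k\<in>I. \<bar>w k\<bar> \<le> real (q + 1) * B q"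
  proof (rule ccontr)
    assume "\<not> ?thesis"
    then have lt: "\<And>k. k \<in> I \<Longrightarrow> real (q + 1) * B q < \<bar>w k\<bar>" by (auto simp: not_le)
    have "1 = \<bar>\<Sum>i\<in>I. poly (Q q) (y i) / w i\<bar>"
      using lagrange_leading_coefficient[OF fin inj, of "Q q"] Qq q by (simp add: w_def)
    also have "\<dots> \<le> (\<Sum>i\<in>I. \<bar>poly (Q q) (y i) / w i\<bar>)" by (rule sum_abs)
    also have "\<dots> < (\<Sum>i\<in>I. 1 / real (q + 1))"
    proof (rule sum_strict_mono[OF fin ne])
      fix i assume i: "i \<in> I"
      have "\<bar>poly (Q q) (y i)\<bar> \<le> B q" using Suc.prems(4)[OF i, of q] q by simp
      then have "real (q + 1) * \<bar>poly (Q q) (y i)\<bar> \<le> real (q + 1) * B q" by (intro mult_left_mono) auto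
      also have "\<dots> < \<bar>w i\<bar>" by (rule lt[OF i])
      finally show "\<bar>poly (Q q) (y i) / w i\<bar> < 1 / real (q + 1)"
        using w[OF i] by (simp add: abs_divide field_simps)
    qed
    also have "\<dots> = 1" using q by simp
    finally show False by simp
  qed
  then obtain k where k: "k \<in> I" "\<bar>w k\<bar> \<le> real (q + 1) * B q" by auto
  define K where "K = I - {k}"
  have K: "finite K" "card K = q" "I = insert k K" "k \<notin> K" using fin k q by (auto simp: K_def)
  have IH: "(\<Sum>i\<in>K. \<Sum>j\<in>K - {i}. ln \<bar>y i - y j\<bar>) \<le> 2 * (\<Sum>j<card K. ln (real (j + 1) * B j))"
  proof (rule Suc.hyps(1))
    show "inj_on y K" using inj by (auto simp: K_def inj_on_def)
    fix j assume "j < card K"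
    then have j: "j < card I" using K q by simp
    show "lead_coeff (Q j) = 1 \<and> degree (Q j) = j" by (rule Suc.prems(3)[OF j])
    show "\<bar>poly (Q j) (y i)\<bar> \<le> B j" if "i \<in> K" for i
      by (rule Suc.prems(4)) (use j that K in auto)
  qed (use K in auto)
  \<comment> \<open>Ordered pairs involving \<open>k\<close> occur once in its own row and once in
    the other rows, so removing \<open>k\<close> splits off
    \<open>2 * ln \<bar>w k\<bar>\<close>.\<close>
  have "(\<Sum>i\<in>K. \<Sum>j\<in>I - {i}. ln \<bar>y i - y j\<bar>) = (\<Sum>i\<in>K. ln \<bar>y i - y k\<bar> + (\<Sum>j\<in>K - {i}. ln \<bar>y i - y j\<bar>))"
  proof (intro sum.cong refl)
    fix i assume i: "i \<in> K"
    then have "I - {i} = insert k (K - {i})" using K by auto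
    then show "(\<Sum>j\<in>I - {i}. ln \<bar>y i - y j\<bar>) = ln \<bar>y i - y k\<bar> + (\<Sum>j\<in>K - {i}. ln \<bar>y i - y j\<bar>)"
      using K by simp
  qed
  also have "\<dots> = (\<Sum>j\<in>K. ln \<bar>y k - y j\<bar>) + (\<Sum>i\<in>K. \<Sum>j\<in>K - {i}. ln \<bar>y i - y j\<bar>)"
    by (simp add: sum.distrib abs_minus_commute)
  finally have "(\<Sum>i\<in>I. \<Sum>j\<in>I - {i}. ln \<bar>y i - y j\<bar>)
      = 2 * (\<Sum>j\<in>K. ln \<bar>y k - y j\<bar>) + (\<Sum>i\<in>K. \<Sum>j\<in>K - {i}. ln \<bar>y i - y j\<bar>)"
    using K by (simp add: K_def[symmetric])
  also have "(\<Sum>j\<in>K. ln \<bar>y k - y j\<bar>) = ln \<bar>w k\<bar>"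
  proof -
    have "\<bar>y k - y j\<bar> \<noteq> 0" if "j \<in> K" for j using that inj k by (auto simp: K_def inj_on_def)
    then show ?thesis using K by (simp add: w_def K_def[symmetric] abs_prod ln_prod)
  qed
  also have "ln \<bar>w k\<bar> \<le> ln (real (q + 1) * B q)" using k w[OF k(1)] by (intro ln_mono) auto
  finally show ?case using IH K q by simp
qed

lemma monic_power_times_X_power:
  fixes P :: "real poly"
  assumes P: "lead_coeff P = 1" "degree P = n"
  shows "lead_coeff (P ^ a * [:0, 1:] ^ b) = 1" "degree (P ^ a * [:0, 1:] ^ b) = a * n + b"
proof -
  have "P \<noteq> 0" using P by auto
  then show "degree (P ^ a * [:0, 1:] ^ b) = a * n + b"
    using P by (simp add: degree_mult_eq degree_power_eq)
  show "lead_coeff (P ^ a * [:0, 1:] ^ b) = 1"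
    using P by (simp only: lead_coeff_mult lead_coeff_power) simp
qed

text \<open>With the polynomials \<open>P ^ (j div n) * x ^ (j mod n)\<close> only the second factor is estimated wastefully;
  the loss is of lower order once there are many more points than the degree \<open>n\<close>.\<close>

lemma vandermonde_bound_powers:
  fixes y :: "'b \<Rightarrow> real" and P :: "real poly"
  assumes fin: "finite I" and inj: "inj_on y I" and P: "lead_coeff P = 1" "degree P = n" "0 < n"
    and small: "\<And>i. i \<in> I \<Longrightarrow> \<bar>poly P (y i)\<bar> \<le> exp (real n * l)"
    and R: "1 \<le> R" "\<And>i. i \<in> I \<Longrightarrow> \<bar>y i\<bar> \<le> R"
    and W: "0 \<le> W" "ln R - l \<le> W" and I: "card I = q"
  shows "(\<Sum>i\<in>I. \<Sum>j\<in>I - {i}. ln \<bar>y i - y j\<bar>)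
    \<le> l * real q * (real q - 1) + 2 * real q * ln (real q) + 2 * real q * real n * W"
proof -
  define Q where "Q j = P ^ (j div n) * [:0, 1:] ^ (j mod n)" for j
  define B where "B j = exp (real n * l) ^ (j div n) * R ^ (j mod n)" for j
  have lnB: "ln (real (j + 1) * B j) \<le> ln (real q) + (real j * l + real n * W)" if j: "j < q" for j
  proof -
    have Bpos: "0 < B j" using R by (simp add: B_def)
    have "ln (B j) = real (j div n) * (real n * l) + real (j mod n) * ln R"
      using R unfolding B_def by (subst ln_mult_pos) (auto simp: ln_realpow)
    \<comment> \<open>Every degree contributes \<open>l\<close>, except the \<open>j mod n\<close>
      degrees coming from powers of \<open>x\<close>, each of which contributes \<open>ln R\<close>.
      \<open>W\<close> bounds this excess.\<close>
    also have "\<dots> = real j * l + real (j mod n) * (ln R - l)"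
    proof -
      have "real j = real (j div n) * real n + real (j mod n)"
        by (metis div_mult_mod_eq of_nat_add of_nat_mult)
      then show ?thesis by (simp add: algebra_simps)
    qed
    also have "real (j mod n) * (ln R - l) \<le> real (j mod n) * W" by (intro mult_left_mono W) auto
    also have "\<dots> \<le> real n * W" using W P by (intro mult_right_mono) (auto intro: less_imp_le)
    finally have "ln (B j) \<le> real j * l + real n * W" by simp
    moreover have "ln (real (j + 1)) \<le> ln (real q)" using j by (intro ln_mono) auto
    moreover have "ln (real (j + 1) * B j) = ln (real (j + 1)) + ln (B j)"
      using Bpos by (intro ln_mult_pos) auto
    ultimately show ?thesis by simp
  qed
  have "(\<Sum>i\<in>I. \<Sum>j\<in>I - {i}. ln \<bar>y i - y j\<bar>) \<le> 2 * (\<Sum>j<card I. ln (real (j + 1) * B j))"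
  proof (rule vandermonde_bound[OF fin inj])
    show "lead_coeff (Q j) = 1 \<and> degree (Q j) = j" for j
      unfolding Q_def using monic_power_times_X_power[OF P(1,2), of "j div n" "j mod n"]
      by (simp only: div_mult_mod_eq)
    show "\<bar>poly (Q j) (y i)\<bar> \<le> B j" if "i \<in> I" for i j
      unfolding Q_def B_def using small[OF that] R(2)[OF that]
      by (simp add: abs_mult power_abs) (intro mult_mono power_mono, auto)
  qed
  also have "\<dots> \<le> 2 * (\<Sum>j<q. ln (real q) + (real j * l + real n * W))"
    unfolding I by (intro mult_left_mono sum_mono lnB) auto
  also have "\<dots> = l * (2 * real (\<Sum>j<q. j)) + 2 * real q * ln (real q) + 2 * real q * real n * W"
    by (simp add: sum.distrib sum_distrib_left algebra_simps)
  also have "2 * real (\<Sum>j<q. j) = real q * (real q - 1)"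
    by (induction q) (auto simp: algebra_simps)
  finally show ?thesis by (simp add: mult.assoc)
qed

section \<open>Lower bound for the norms\<close>

text \<open>Chebyshev's inequality: a polynomial above \<open>r / sqrt t\<close> on a window of mass
  more than \<open>t\<close> would have squared norm above \<open>r\<^sup>2\<close>.\<close>

lemma exists_small_value_of_integral:
  fixes P :: "real poly"
  assumes s: "sets \<mu> = sets borel" and fin: "emeasure \<mu> UNIV < \<infinity>"
    and bd: "AE x in \<mu>. \<bar>x\<bar> \<le> b" and t: "0 < t" "t < measure \<mu> {u..v}"
    and r: "0 < r" "sqrt (\<integral>x. (poly P x)\<^sup>2 \<partial>\<mu>) < r"
  shows "\<exists>y\<in>{u..v}. \<bar>poly P y\<bar> \<le> r / sqrt t"
proof (rule ccontr)
  assume neg: "\<not> ?thesis"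
  have sp: "space \<mu> = UNIV" using sets_eq_imp_space_eq[OF s] by simp
  interpret finite_measure \<mu> using fin by (intro finite_measureI) (simp add: sp)
  note [measurable_cong] = s
  have [measurable]: "(\<lambda>x. poly P x) \<in> borel_measurable borel"
    by (intro borel_measurable_continuous_onI continuous_intros)
  \<comment> \<open>Integrability is essential, because the integral of a nonintegrable function is
    0 by convention.\<close>
  have int: "integrable \<mu> (\<lambda>x. (poly P x)\<^sup>2)"
  proof -
    have "compact {-b..b}" by simp
    moreover have "continuous_on {-b..b} (\<lambda>x. (poly P x)\<^sup>2)" by (intro continuous_intros)
    ultimately have "bounded ((\<lambda>x. (poly P x)\<^sup>2) ` {-b..b})"
      by (intro compact_imp_bounded compact_continuous_image)
    then have "\<exists>C. \<forall>x\<in>{-b..b}. norm ((poly P x)\<^sup>2) \<le> C" by (simp add: bounded_iff)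
    then obtain C where C: "\<forall>x\<in>{-b..b}. norm ((poly P x)\<^sup>2) \<le> C" ..
    show ?thesis
    proof (rule integrable_const_bound)
      show "AE x in \<mu>. norm ((poly P x)\<^sup>2) \<le> C" by (rule eventually_mono[OF bd], rule C[rule_format]) auto
    qed measurable
  qed
  have "(\<integral>x. r\<^sup>2 / t * indicator {u..v} x \<partial>\<mu>) \<le> (\<integral>x. (poly P x)\<^sup>2 \<partial>\<mu>)"
  proof (rule integral_mono[OF _ int])
    show "integrable \<mu> (\<lambda>x. r\<^sup>2 / t * indicator {u..v} x)"
      by (intro integrable_mult_right integrable_real_indicator) (auto simp: s less_top[symmetric])
    show "r\<^sup>2 / t * indicator {u..v} x \<le> (poly P x)\<^sup>2" for x
    proof (cases "x \<in> {u..v}")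
      case True
      then have "r / sqrt t \<le> \<bar>poly P x\<bar>" using neg by force
      then have "(r / sqrt t)\<^sup>2 \<le> \<bar>poly P x\<bar>\<^sup>2" using r t by (intro power_mono) auto
      then show ?thesis using True t by (simp add: power_divide)
    qed simp
  qed
  then have "r\<^sup>2 / t * measure \<mu> {u..v} \<le> (\<integral>x. (poly P x)\<^sup>2 \<partial>\<mu>)" by (simp add: sp)
  also have "\<dots> < r\<^sup>2" using r using real_sqrt_less_iff[of "\<integral>x. (poly P x)\<^sup>2 \<partial>\<mu>" "r\<^sup>2"] by simp
  finally have "r\<^sup>2 * measure \<mu> {u..v} < r\<^sup>2 * t" using t by (simp add: field_simps)
  then show False using t r by simp
qed

text \<open>The intervals are the sections of the closed strip \<open>Q\<close> around the diagonal,
  and the mass of a section depends measurably on \<open>x\<close>. The density bound can be applied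
  to the bad set because of this.\<close>

lemma sets_small_interval_measure:
  fixes E :: "real set"
  assumes s: "sets \<mu> = sets borel" and fin: "emeasure \<mu> UNIV < \<infinity>" and E: "E \<in> sets borel"
  shows "{x \<in> E. measure \<mu> {x - d..x + d} \<le> t} \<in> sets borel"
proof -
  have sp: "space \<mu> = UNIV" using sets_eq_imp_space_eq[OF s] by simp
  interpret finite_measure \<mu> using fin by (intro finite_measureI) (simp add: sp)
  note [measurable_cong] = s
  define Q where "Q = {z \<in> space (borel \<Otimes>\<^sub>M borel). fst z - d \<le> snd z \<and> snd z \<le> fst z + (d :: real)}"
  have "Q \<in> sets (borel \<Otimes>\<^sub>M borel)" unfolding Q_def by measurable
  also have "sets (borel \<Otimes>\<^sub>M borel) = sets (borel \<Otimes>\<^sub>M \<mu>)" by (intro sets_pair_measure_cong) (simp_all add: s)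
  finally have "(\<lambda>x. emeasure \<mu> (Pair x -` Q)) \<in> borel_measurable borel"
    by (rule measurable_emeasure_Pair)
  moreover have "Pair x -` Q = {x - d..x + d}" for x by (auto simp: Q_def space_pair_measure)
  ultimately have [measurable]: "(\<lambda>x. measure \<mu> {x - d..x + d}) \<in> borel_measurable borel"
    unfolding measure_def by simp
  have "{x \<in> space borel. x \<in> E \<and> measure \<mu> {x - d..x + d} \<le> t} \<in> sets borel"
    using E by measurable
  then show ?thesis by simp
qed

section \<open>Configurations with few bad points and few close pairs\<close>

text \<open>Points in \<open>A\<close> and pairs closer than \<open>s\<close> are turned into costs
  \<open>lam\<close>, added to the field and to the kernel. As all costs are nonnegative, a single
  averaging controls the energy and both kinds of defects for the same tuple; the density bound
  estimates the mean costs.\<close>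

lemma exists_spread_tuple:
  assumes nu: "\<nu> \<in> prob_on E" and E: "compact E"
    and dens: "\<And>A. A \<in> sets borel \<Longrightarrow> emeasure \<nu> A \<le> ennreal R * emeasure lborel A"
    and en: "kern_energy D \<nu> \<le> ennreal V" and A: "A \<in> sets borel" "A \<subseteq> E"
    and nn: "0 \<le> R" "0 \<le> V" "0 \<le> lam" "0 < s"
  shows "\<exists>x. (\<forall>i<M. x i \<in> E) \<and>
     (\<Sum>i<M. ennreal lam * indicator A (x i)) +
     (\<Sum>i<M. \<Sum>j<i. log_kern D (x i) (x j) + (if \<bar>x i - x j\<bar> < s then ennreal lam else 0))
     \<le> ennreal (real M * (lam * (R * measure lborel A)) + (real M)\<^sup>2 / 2 * (V + lam * (R * (2 * s))))"
proof -
  interpret prob_space \<nu> using nu by (simp add: prob_on_def)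
  have s [measurable_cong]: "sets \<nu> = sets borel" using nu by (simp add: prob_on_def)
  note [measurable] = A(1)
  have Eb: "E \<in> sets borel" using E by (simp add: borel_compact)
  let ?h = "\<lambda>x. ennreal lam * indicator A x :: ennreal"
  let ?c = "\<lambda>x y. if \<bar>x - y\<bar> < s then ennreal lam else 0"
  let ?g = "\<lambda>x y. log_kern D x y + ?c x y"
  have m: "(\<lambda>(x, y). ?g x y) \<in> borel_measurable (borel \<Otimes>\<^sub>M borel)" by measurable
  have "?h \<in> borel_measurable borel" by measurable
  from exists_tuple_le_energy[OF nu Eb m this] obtain x where x: "\<forall>i<M. x i \<in> E"
    and le: "(\<Sum>i<M. ?h (x i)) + (\<Sum>i<M. \<Sum>j<i. ?g (x i) (x j))
      \<le> of_nat M * (\<integral>\<^sup>+ x. ?h x \<partial>\<nu>) + of_nat (\<Sum>i<M. i) * (\<integral>\<^sup>+ x. \<integral>\<^sup>+ y. ?g y x \<partial>\<nu> \<partial>\<nu>)" by blast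
  have fA: "emeasure lborel A < \<infinity>"
    using emeasure_mono[OF A(2), of lborel] emeasure_compact_finite[OF E] Eb by (simp add: le_less_trans)
  have h: "(\<integral>\<^sup>+ x. ?h x \<partial>\<nu>) \<le> ennreal (lam * (R * measure lborel A))"
  proof -
    have "(\<integral>\<^sup>+ x. ?h x \<partial>\<nu>) = ennreal lam * emeasure \<nu> A" using s by (subst nn_integral_cmult) auto
    also have "\<dots> \<le> ennreal lam * (ennreal R * emeasure lborel A)" by (intro mult_left_mono dens A) auto
    also have "emeasure lborel A = ennreal (measure lborel A)" using fA by (intro emeasure_eq_ennreal_measure) auto
    finally show ?thesis using nn by (simp add: ennreal_mult[symmetric])
  qed
  have g: "(\<integral>\<^sup>+ x. \<integral>\<^sup>+ y. ?g y x \<partial>\<nu> \<partial>\<nu>) \<le> ennreal (V + lam * (R * (2 * s)))"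
  proof -
    have "(\<integral>\<^sup>+ y. ?c y x \<partial>\<nu>) \<le> ennreal (lam * (R * (2 * s)))" for x
    proof -
      have "(\<integral>\<^sup>+ y. ?c y x \<partial>\<nu>) = (\<integral>\<^sup>+ y. ennreal lam * indicator {x - s<..<x + s} y \<partial>\<nu>)"
        by (intro nn_integral_cong) (auto simp: abs_less_iff split: split_indicator)
      also have "\<dots> = ennreal lam * emeasure \<nu> {x - s<..<x + s}" using s by (subst nn_integral_cmult) auto
      also have "\<dots> \<le> ennreal lam * (ennreal R * emeasure lborel {x - s<..<x + s})"
        by (intro mult_left_mono dens) auto
      also have "\<dots> = ennreal (lam * (R * (2 * s)))" using nn by (simp add: ennreal_mult[symmetric])
      finally show ?thesis .
    qed
    then have "(\<integral>\<^sup>+ x. \<integral>\<^sup>+ y. ?g y x \<partial>\<nu> \<partial>\<nu>) \<le> (\<integral>\<^sup>+ x. (\<integral>\<^sup>+ y. log_kern D y x \<partial>\<nu>) + ennreal (lam * (R * (2 * s))) \<partial>\<nu>)"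
      by (intro nn_integral_mono) (subst nn_integral_add, auto intro!: add_left_mono)
    also have "\<dots> = (\<integral>\<^sup>+ x. \<integral>\<^sup>+ y. log_kern D y x \<partial>\<nu> \<partial>\<nu>) + ennreal (lam * (R * (2 * s)))"
      by (subst nn_integral_add) (auto simp: emeasure_space_1)
    also have "(\<integral>\<^sup>+ x. \<integral>\<^sup>+ y. log_kern D y x \<partial>\<nu> \<partial>\<nu>) = kern_energy D \<nu>"
      unfolding kern_energy_def by (subst log_kern_commute) simp
    also have "kern_energy D \<nu> + ennreal (lam * (R * (2 * s))) \<le> ennreal V + ennreal (lam * (R * (2 * s)))"
      by (intro add_right_mono en)
    also have "\<dots> = ennreal (V + lam * (R * (2 * s)))" using nn by (intro ennreal_plus[symmetric]) auto
    finally show ?thesis .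
  qed
  have "of_nat M * (\<integral>\<^sup>+ x. ?h x \<partial>\<nu>) + of_nat (\<Sum>i<M. i) * (\<integral>\<^sup>+ x. \<integral>\<^sup>+ y. ?g y x \<partial>\<nu> \<partial>\<nu>)
    \<le> ennreal (real M) * ennreal (lam * (R * measure lborel A)) + ennreal ((real M)\<^sup>2 / 2) * ennreal (V + lam * (R * (2 * s)))"
    unfolding ennreal_of_nat_eq_real_of_nat by (intro add_mono mult_mono h g ennreal_leI real_sum_lessThan_le) auto
  also have "\<dots> = ennreal (real M * (lam * (R * measure lborel A)) + (real M)\<^sup>2 / 2 * (V + lam * (R * (2 * s))))"
    using nn by (simp add: ennreal_mult[symmetric] ennreal_plus[symmetric] del: ennreal_plus)
  finally show ?thesis using x le by (meson order_trans)
qed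

text \<open>Each bad index costs at least \<open>lam\<close>, so the budget \<open>\<tau>\<close>
  admits at most \<open>p\<close> of them. Deleting them does not raise the energy, as the kernel is
  nonnegative. The factor 2 passes from pairs \<open>j < i\<close> to ordered pairs.\<close>

lemma exists_separated_subset:
  fixes x :: "nat \<Rightarrow> real"
  assumes le: "(\<Sum>i<M. ennreal lam * indicator A (x i)) +
     (\<Sum>i<M. \<Sum>j<i. log_kern D (x i) (x j) + (if \<bar>x i - x j\<bar> < s then ennreal lam else 0)) \<le> ennreal \<tau>"
    and pos: "0 < lam" "0 < s" "0 \<le> \<tau>" and bound: "\<tau> \<le> lam * real p" and M: "M = p + q"
    and E: "\<And>i. i < M \<Longrightarrow> x i \<in> E" and D: "0 < D" and diam: "\<And>x y. x \<in> E \<Longrightarrow> y \<in> E \<Longrightarrow> \<bar>x - y\<bar> \<le> D"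
  shows "\<exists>I. finite I \<and> I \<subseteq> {..<M} \<and> card I = q \<and> (\<forall>i\<in>I. x i \<notin> A) \<and>
    (\<forall>i\<in>I. \<forall>j\<in>I - {i}. s \<le> \<bar>x i - x j\<bar>) \<and>
    (\<Sum>i\<in>I. \<Sum>j\<in>I - {i}. ln (D / \<bar>x i - x j\<bar>)) \<le> 2 * \<tau>"
proof -
  \<comment> \<open>Of a close pair only the later index is bad, so that each bad index is paid for
    by its own row of the double sum.\<close>
  define bad where "bad = {i. i < M \<and> (x i \<in> A \<or> (\<exists>j<i. \<bar>x i - x j\<bar> < s))}"
  let ?c = "\<lambda>i j. if \<bar>x i - x j\<bar> < s then ennreal lam else 0"
  have fb: "finite bad" "bad \<subseteq> {..<M}" by (auto simp: bad_def)
  have "ennreal lam * of_nat (card bad) = (\<Sum>i\<in>bad. ennreal lam)" by (simp add: mult.commute)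
  also have "\<dots> \<le> (\<Sum>i\<in>bad. ennreal lam * indicator A (x i) + (\<Sum>j<i. ?c i j))"
  proof (rule sum_mono)
    fix i assume i: "i \<in> bad"
    show "ennreal lam \<le> ennreal lam * indicator A (x i) + (\<Sum>j<i. ?c i j)"
    proof (cases "x i \<in> A")
      case False
      then obtain j where j: "j < i" "\<bar>x i - x j\<bar> < s" using i by (auto simp: bad_def)
      then have "ennreal lam = ?c i j" by simp
      also have "\<dots> \<le> (\<Sum>j<i. ?c i j)" using j by (intro member_le_sum) auto
      finally show ?thesis by (rule order_trans) simp
    qed simp
  qed
  also have "\<dots> \<le> (\<Sum>i<M. ennreal lam * indicator A (x i) + (\<Sum>j<i. ?c i j))"
    using fb by (intro sum_mono2) auto
  also have "\<dots> \<le> (\<Sum>i<M. ennreal lam * indicator A (x i)) + (\<Sum>i<M. \<Sum>j<i. log_kern D (x i) (x j) + ?c i j)"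
    unfolding sum.distrib[of "\<lambda>i. ennreal lam * indicator A (x i)"] by (intro add_left_mono sum_mono) simp
  also have "\<dots> \<le> ennreal (lam * real p)" using le bound by (meson ennreal_leI order_trans)
  finally have "ennreal (lam * real (card bad)) \<le> ennreal (lam * real p)"
    using pos by (simp add: ennreal_mult ennreal_of_nat_eq_real_of_nat)
  then have "card bad \<le> p" using pos by (simp add: ennreal_le_iff)
  then have "q \<le> card ({..<M} - bad)" using M fb by (simp add: card_Diff_subset)
  then obtain I where I: "I \<subseteq> {..<M} - bad" "card I = q" "finite I"
    by (meson obtain_subset_with_card_n)
  have sep1: "s \<le> \<bar>x i - x j\<bar>" if "i \<in> I" "j < i" for i j
  proof -
    have "i < M" "i \<notin> bad" using I that by auto
    then have "\<not> \<bar>x i - x j\<bar> < s" using that(2) unfolding bad_def by blast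
    then show ?thesis by simp
  qed
  have sep: "s \<le> \<bar>x i - x j\<bar>" if "i \<in> I" "j \<in> I" "i \<noteq> j" for i j
    using sep1[of i j] sep1[of j i] that by (cases i j rule: linorder_cases) (auto simp: abs_minus_commute)
  have "ennreal (\<Sum>i\<in>I. \<Sum>j\<in>{j\<in>I. j < i}. ln (D / \<bar>x i - x j\<bar>))
      = (\<Sum>i\<in>I. \<Sum>j\<in>{j\<in>I. j < i}. log_kern D (x i) (x j))"
  proof -
    have ne: "x i \<noteq> x j" if "i \<in> I" "j \<in> I" "j < i" for i j using sep[of i j] that pos by auto
    have l0: "0 \<le> ln (D / \<bar>x i - x j\<bar>)" if "i \<in> I" "j \<in> I" "j < i" for i j
    proof -
      have "x i \<in> E" "x j \<in> E" using I that E by auto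
      then show ?thesis using diam[of "x i" "x j"] ne[OF that] by (intro ln_ge_zero) auto
    qed
    have "(\<Sum>i\<in>I. \<Sum>j\<in>{j\<in>I. j < i}. log_kern D (x i) (x j)) = (\<Sum>i\<in>I. ennreal (\<Sum>j\<in>{j\<in>I. j < i}. ln (D / \<bar>x i - x j\<bar>)))"
    proof (rule sum.cong[OF refl])
      fix i assume i: "i \<in> I"
      have "(\<Sum>j\<in>{j\<in>I. j < i}. log_kern D (x i) (x j)) = (\<Sum>j\<in>{j\<in>I. j < i}. ennreal (ln (D / \<bar>x i - x j\<bar>)))"
        using ne[OF i] by (intro sum.cong) (auto simp: log_kern_def)
      also have "\<dots> = ennreal (\<Sum>j\<in>{j\<in>I. j < i}. ln (D / \<bar>x i - x j\<bar>))"
        using l0[OF i] by (intro sum_ennreal) auto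
      finally show "(\<Sum>j\<in>{j\<in>I. j < i}. log_kern D (x i) (x j)) = ennreal (\<Sum>j\<in>{j\<in>I. j < i}. ln (D / \<bar>x i - x j\<bar>))" .
    qed
    also have "\<dots> = ennreal (\<Sum>i\<in>I. \<Sum>j\<in>{j\<in>I. j < i}. ln (D / \<bar>x i - x j\<bar>))"
      using l0 by (intro sum_ennreal sum_nonneg) auto
    finally show ?thesis by simp
  qed
  also have "\<dots> \<le> (\<Sum>i<M. \<Sum>j<i. log_kern D (x i) (x j) + ?c i j)"
  proof -
    have "(\<Sum>i\<in>I. \<Sum>j\<in>{j\<in>I. j < i}. log_kern D (x i) (x j)) \<le> (\<Sum>i\<in>I. \<Sum>j<i. log_kern D (x i) (x j))"
      by (intro sum_mono sum_mono2) auto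
    also have "\<dots> \<le> (\<Sum>i<M. \<Sum>j<i. log_kern D (x i) (x j))" using I by (intro sum_mono2) auto
    also have "\<dots> \<le> (\<Sum>i<M. \<Sum>j<i. log_kern D (x i) (x j) + ?c i j)" by (intro sum_mono) simp
    finally show ?thesis .
  qed
  also have "\<dots> \<le> ennreal \<tau>" using le by (meson add_increasing order_refl order_trans zero_le)
  finally have "(\<Sum>i\<in>I. \<Sum>j\<in>{j\<in>I. j < i}. ln (D / \<bar>x i - x j\<bar>)) \<le> \<tau>"
    using pos by (simp add: ennreal_le_iff)
  moreover have "(\<Sum>i\<in>I. \<Sum>j\<in>I - {i}. ln (D / \<bar>x i - x j\<bar>))
    = (\<Sum>i\<in>I. \<Sum>j\<in>{j\<in>I. j < i}. ln (D / \<bar>x i - x j\<bar>)) + (\<Sum>i\<in>I. \<Sum>j\<in>{j\<in>I. j < i}. ln (D / \<bar>x i - x j\<bar>))"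
    by (rule sum_symmetric_off_diagonal[OF I(3)]) (simp add: abs_minus_commute)
  ultimately have "(\<Sum>i\<in>I. \<Sum>j\<in>I - {i}. ln (D / \<bar>x i - x j\<bar>)) \<le> 2 * \<tau>" by simp
  moreover have "\<forall>i\<in>I. x i \<notin> A" using I by (auto simp: bad_def)
  ultimately show ?thesis using I sep by (intro exI[of _ I]) auto
qed

text \<open>One quantity is estimated twice, the sum of \<open>ln \<bar>y i - y j\<bar>\<close> over
  ordered pairs of \<open>k * n\<close> displaced points: from below by the energy of the original
  points, from above by the Vandermonde bound. All errors are explicit; the parameters are chosen in
  \<open>eventually_monic_norm_ge\<close>.\<close>

lemma small_norm_energy_bound:
  fixes P :: "real poly" and A :: "real set" and k n H :: nat
  assumes nu: "\<nu> \<in> prob_on E" and E: "compact E"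
    and dens: "\<And>A. A \<in> sets borel \<Longrightarrow> emeasure \<nu> A \<le> ennreal R * emeasure lborel A"
    and en: "kern_energy D \<nu> \<le> ennreal V" and D: "1 \<le> D"
    and diam: "\<And>x y. x \<in> E \<Longrightarrow> y \<in> E \<Longrightarrow> \<bar>x - y\<bar> \<le> D"
    and mu: "sets \<mu> = sets borel" "emeasure \<mu> UNIV < \<infinity>" "AE x in \<mu>. \<bar>x\<bar> \<le> b"
    and b: "1 \<le> b" "\<And>x. x \<in> E \<Longrightarrow> \<bar>x\<bar> + 1 \<le> b"
    and P: "lead_coeff P = 1" "degree P = n" "sqrt (\<integral>x. (poly P x)\<^sup>2 \<partial>\<mu>) < c ^ n"
    and nn: "0 \<le> R" "0 \<le> V" "0 < n" "0 < H" "0 < al" "2 < S" "0 < c"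
    and W: "0 \<le> W" "ln b - (ln c + real H * \<eta> / 2) \<le> W"
    and A: "A = {x \<in> E. measure \<mu> {x - 1 / real (H * n)..x + 1 / real (H * n)} \<le> exp (- real (H * n) * \<eta>)}"
    and \<tau>: "\<tau> = real ((k + 1) * n) * (al * real n * (R * measure lborel A))
      + (real ((k + 1) * n))\<^sup>2 / 2 * (V + al * real n * (R * (2 * (S / real (H * n)))))"
    and small: "\<tau> \<le> al * real n * real n"
  shows "real (k * n) * (real (k * n) - 1) * (ln D + ln (1 - 2 / S)) - 2 * \<tau>
    \<le> (ln c + real H * \<eta> / 2) * real (k * n) * (real (k * n) - 1)
       + 2 * real (k * n) * ln (real (k * n)) + 2 * real (k * n) * real n * W"
proof -
  define m where "m = real (H * n)"
  define s where "s = S / m"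
  \<comment> \<open>Outside \<open>A\<close> a window has mass above
    \<open>exp (- m * \<eta>)\<close>, so \<open>P\<close> is at most
    \<open>c ^ n * exp (m * \<eta> / 2) = exp (n * l)\<close> somewhere in it.\<close>
  define l where "l = ln c + real H * \<eta> / 2"
  \<comment> \<open>Points at least \<open>S / m\<close> apart move by at most \<open>1 / m\<close>
    each, so distances shrink at most by this factor.\<close>
  define \<kappa> where "\<kappa> = 1 - 2 / S"
  have m: "1 \<le> m" using nn by (simp add: m_def flip: of_nat_mult)
  have s: "0 < s" using nn m by (simp add: s_def)
  have \<kappa>: "0 < \<kappa>" using nn by (simp add: \<kappa>_def)
  have Eb: "E \<in> sets borel" using E by (simp add: borel_compact)
  have Ab: "A \<in> sets borel" "A \<subseteq> E"
    using sets_small_interval_measure[OF mu(1,2) Eb] by (auto simp: A)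
  have tau0: "0 \<le> \<tau>" unfolding \<tau> using nn by (intro add_nonneg_nonneg mult_nonneg_nonneg) auto
  have lam: "0 \<le> al * real n" "0 < al * real n" using nn by auto
  obtain x where xE: "\<forall>i<(k + 1) * n. x i \<in> E" and le:
     "(\<Sum>i<(k + 1) * n. ennreal (al * real n) * indicator A (x i)) +
     (\<Sum>i<(k + 1) * n. \<Sum>j<i. log_kern D (x i) (x j) + (if \<bar>x i - x j\<bar> < s then ennreal (al * real n) else 0)) \<le> ennreal \<tau>"
    using exists_spread_tuple[OF nu E dens en Ab nn(1,2) lam(1) s, of "(k + 1) * n"]
    unfolding \<tau> s_def m_def by auto
  \<comment> \<open>The \<open>n\<close> spare points are those that may be deleted: by
    \<open>small\<close> the budget pays for at most \<open>n\<close> bad indices at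
    \<open>al * real n\<close> each.\<close>
  have M: "(k + 1) * n = n + k * n" by simp
  have D0: "0 < D" using D by simp
  obtain I where I: "finite I" "I \<subseteq> {..<(k + 1) * n}" "card I = k * n" "\<forall>i\<in>I. x i \<notin> A"
    and sep: "\<forall>i\<in>I. \<forall>j\<in>I - {i}. s \<le> \<bar>x i - x j\<bar>"
    and sum: "(\<Sum>i\<in>I. \<Sum>j\<in>I - {i}. ln (D / \<bar>x i - x j\<bar>)) \<le> 2 * \<tau>"
    using exists_separated_subset[OF le lam(2) s tau0 small M xE[rule_format] D0 diam] by blast
  have "\<exists>y. \<bar>y - x i\<bar> \<le> 1 / m \<and> \<bar>poly P y\<bar> \<le> exp (real n * l)" if "i \<in> I" for i
  proof -
    have "x i \<in> E" "x i \<notin> A" using xE I that by auto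
    then have t: "exp (- m * \<eta>) < measure \<mu> {x i - 1 / m..x i + 1 / m}"
      unfolding A m_def by (auto simp: not_le)
    have "0 < exp (- m * \<eta>)" "0 < c ^ n" using nn by auto
    from exists_small_value_of_integral[OF mu this(1) t this(2) P(3)]
    obtain y where y: "y \<in> {x i - 1 / m..x i + 1 / m}" "\<bar>poly P y\<bar> \<le> c ^ n / sqrt (exp (- m * \<eta>))" by blast
    have "sqrt (exp (- m * \<eta>)) = exp (- m * \<eta> / 2)"
      by (rule real_sqrt_unique) (auto simp: power2_eq_square exp_add[symmetric])
    moreover have "c ^ n = exp (real n * ln c)" using nn by (simp add: exp_of_nat_mult)
    ultimately have "c ^ n / sqrt (exp (- m * \<eta>)) = exp (real n * ln c - (- m * \<eta> / 2))"
      by (simp only: exp_diff)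
    also have "real n * ln c - (- m * \<eta> / 2) = real n * l" by (simp add: l_def m_def algebra_simps)
    finally show ?thesis using y by (intro exI[of _ y]) (auto simp: abs_le_iff)
  qed
  then obtain y where y: "\<And>i. i \<in> I \<Longrightarrow> \<bar>y i - x i\<bar> \<le> 1 / m" "\<And>i. i \<in> I \<Longrightarrow> \<bar>poly P (y i)\<bar> \<le> exp (real n * l)"
    by metis
  have dist: "0 < \<bar>x i - x j\<bar> \<and> \<bar>x i - x j\<bar> * \<kappa> \<le> \<bar>y i - y j\<bar>" if ij: "i \<in> I" "j \<in> I" "i \<noteq> j" for i j
  proof -
    have d: "s \<le> \<bar>x i - x j\<bar>" using sep ij by auto
    have "2 / m = 2 / S * s" using nn m by (simp add: s_def)
    also have "\<dots> \<le> 2 / S * \<bar>x i - x j\<bar>" using nn d by (intro mult_left_mono) auto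
    finally have "2 / m \<le> 2 / S * \<bar>x i - x j\<bar>" .
    moreover have "\<bar>x i - x j\<bar> - 2 / m \<le> \<bar>y i - y j\<bar>" using y(1)[OF ij(1)] y(1)[OF ij(2)] by linarith
    ultimately show ?thesis using s d by (auto simp: \<kappa>_def algebra_simps)
  qed
  have inj: "inj_on y I"
  proof (rule inj_onI, rule ccontr)
    fix i j assume "i \<in> I" "j \<in> I" "y i = y j" "i \<noteq> j"
    then have "0 < \<bar>x i - x j\<bar> * \<kappa>" "\<bar>x i - x j\<bar> * \<kappa> \<le> 0" using dist[of i j] \<kappa> by auto
    then show False by linarith
  qed
  have "\<bar>y i\<bar> \<le> b" if i: "i \<in> I" for i
  proof -
    have "\<bar>x i\<bar> + 1 \<le> b" using xE I i by (intro b(2)) auto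
    moreover have "1 / m \<le> 1" using m by simp
    ultimately show ?thesis using y(1)[OF i] by linarith
  qed
  then have upper: "(\<Sum>i\<in>I. \<Sum>j\<in>I - {i}. ln \<bar>y i - y j\<bar>)
    \<le> l * real (k * n) * (real (k * n) - 1) + 2 * real (k * n) * ln (real (k * n)) + 2 * real (k * n) * real n * W"
    using vandermonde_bound_powers[OF I(1) inj P(1,2) nn(3) y(2) b(1) _ W(1) _ I(3)] W(2) by (simp add: l_def)
  have "(\<Sum>i\<in>I. \<Sum>j\<in>I - {i}. (ln D + ln \<kappa>) - ln (D / \<bar>x i - x j\<bar>)) \<le> (\<Sum>i\<in>I. \<Sum>j\<in>I - {i}. ln \<bar>y i - y j\<bar>)"
  proof (intro sum_mono)
    fix i j assume "i \<in> I" "j \<in> I - {i}"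
    then have d: "0 < \<bar>x i - x j\<bar>" "\<bar>x i - x j\<bar> * \<kappa> \<le> \<bar>y i - y j\<bar>" using dist[of i j] by auto
    have "(ln D + ln \<kappa>) - ln (D / \<bar>x i - x j\<bar>) = ln \<bar>x i - x j\<bar> + ln \<kappa>"
      using D d by (simp add: ln_div)
    also have "\<dots> = ln (\<bar>x i - x j\<bar> * \<kappa>)" using ln_mult_pos[OF d(1) \<kappa>] by simp
    also have "\<dots> \<le> ln \<bar>y i - y j\<bar>" using d \<kappa> by (intro ln_mono mult_pos_pos) auto
    finally show "(ln D + ln \<kappa>) - ln (D / \<bar>x i - x j\<bar>) \<le> ln \<bar>y i - y j\<bar>" .
  qed
  moreover have "(\<Sum>i\<in>I. \<Sum>j\<in>I - {i}. (ln D + ln \<kappa>) - ln (D / \<bar>x i - x j\<bar>))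
     = real (k * n) * (real (k * n) - 1) * (ln D + ln \<kappa>) - (\<Sum>i\<in>I. \<Sum>j\<in>I - {i}. ln (D / \<bar>x i - x j\<bar>))"
  proof -
    have "(\<Sum>j\<in>I - {i}. ln D + ln \<kappa>) = (real (k * n) - 1) * (ln D + ln \<kappa>)" if "i \<in> I" for i
    proof -
      have "0 < card I" using that I(1) card_gt_0_iff by blast
      then show ?thesis using that I by (simp add: of_nat_diff Suc_le_eq)
    qed
    then have "(\<Sum>i\<in>I. \<Sum>j\<in>I - {i}. ln D + ln \<kappa>) = (\<Sum>i\<in>I. (real (k * n) - 1) * (ln D + ln \<kappa>))"
      by (rule sum.cong[OF refl])
    also have "\<dots> = real (k * n) * ((real (k * n) - 1) * (ln D + ln \<kappa>))"
      using I(3) by simp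
    finally have "(\<Sum>i\<in>I. \<Sum>j\<in>I - {i}. ln D + ln \<kappa>) = real (k * n) * ((real (k * n) - 1) * (ln D + ln \<kappa>))" .
    then show ?thesis by (simp only: sum_subtractf mult.assoc)
  qed
  ultimately show ?thesis using upper sum unfolding l_def \<kappa>_def by linarith
qed

text \<open>A nearly minimal measure may be singular. Averaging extracts long tuples of nearly
  minimal energy from it, and smearing these gives a density, each of the two steps spending
  \<open>e / 2\<close>.\<close>

lemma exists_bounded_density_near_robin:
  assumes thick: "thick_at_scale r0 E" and D: "0 < D" and E: "E \<in> sets borel"
    and J: "kern_robin D E = ennreal J" "0 \<le> J" and e: "0 < e"
  shows "\<exists>\<nu>\<in>prob_on E. \<exists>R>0. (\<forall>A\<in>sets borel. emeasure \<nu> A \<le> ennreal R * emeasure lborel A) \<and>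
     kern_energy D \<nu> \<le> ennreal (J + e)"
proof -
  have "kern_robin D E < ennreal (J + e / 2)" using J e by (simp add: ennreal_less_iff del: ennreal_plus)
  then obtain \<nu> where nu: "\<nu> \<in> prob_on E" "kern_energy D \<nu> < ennreal (J + e / 2)"
    by (auto simp: kern_robin_def INF_less_iff simp del: ennreal_plus)
  have "\<exists>N\<ge>N0. \<exists>x. (\<forall>i<N. x i \<in> E) \<and>
      (\<Sum>i<N. \<Sum>j<i. log_kern D (x i) (x j)) \<le> ennreal ((real N)\<^sup>2 / 2 * (J + e / 2))" for N0
  proof -
    have "(\<lambda>_. 0 :: ennreal) \<in> borel_measurable borel" by simp
    from exists_tuple_le_energy[OF nu(1) E measurable_log_kern this, where k = N0]
    obtain x where x: "\<forall>i<N0. x i \<in> E" and le: "(\<Sum>i<N0. \<Sum>j<i. log_kern D (x i) (x j))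
        \<le> of_nat (\<Sum>i<N0. i) * (\<integral>\<^sup>+ x. \<integral>\<^sup>+ y. log_kern D y x \<partial>\<nu> \<partial>\<nu>)" by auto
    have "(\<integral>\<^sup>+ x. \<integral>\<^sup>+ y. log_kern D y x \<partial>\<nu> \<partial>\<nu>) = kern_energy D \<nu>"
      unfolding kern_energy_def by (subst log_kern_commute) simp
    note le
    also have "of_nat (\<Sum>i<N0. i) * (\<integral>\<^sup>+ x. \<integral>\<^sup>+ y. log_kern D y x \<partial>\<nu> \<partial>\<nu>)
      \<le> ennreal ((real N0)\<^sup>2 / 2) * ennreal (J + e / 2)"
      unfolding \<open>_ = kern_energy D \<nu>\<close> ennreal_of_nat_eq_real_of_nat
      using nu by (intro mult_mono ennreal_leI real_sum_lessThan_le) auto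
    also have "\<dots> = ennreal ((real N0)\<^sup>2 / 2 * (J + e / 2))"
      using J e by (intro ennreal_mult[symmetric]) auto
    finally show ?thesis using x by blast
  qed
  from exists_bounded_density_of_tuples[OF thick D _ E this, of "e / 2"] J e show ?thesis by (simp add: add.commute)
qed

lemma eventually_monic_norm_ge:
  assumes thick: "thick_at_scale r0 E" and E: "compact E" "E \<noteq> {}" and D: "1 \<le> D"
    and diam: "\<And>x y. x \<in> E \<Longrightarrow> y \<in> E \<Longrightarrow> \<bar>x - y\<bar> \<le> D"
    and mu: "sets \<mu> = sets borel" "emeasure \<mu> UNIV < \<infinity>" "AE x in \<mu>. \<bar>x\<bar> \<le> b0"
    and lim: "\<And>\<eta>::real. \<eta> > 0 \<Longrightarrow>
          (\<lambda>m::nat. measure lborel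
              {x \<in> E. measure \<mu> {x - 1 / real m .. x + 1 / real m} \<le> exp (- real m * \<eta>)})
          \<longlonglongrightarrow> 0"
    and c: "0 < c" "c < log_capacity E"
  shows "\<forall>\<^sub>F n in sequentially. \<forall>P :: real poly. lead_coeff P = 1 \<and> degree P = n \<longrightarrow>
    c ^ n \<le> sqrt (\<integral>x. (poly P x)\<^sup>2 \<partial>\<mu>)"
proof -
  have Eb: "E \<in> sets borel" using E by (simp add: borel_compact)
  have D0: "0 < D" using D by simp
  obtain J where J: "kern_robin D E = ennreal J" "0 \<le> J"
    using kern_robin_finite[OF thick D0 Eb E(2)] by (cases "kern_robin D E") auto
  \<comment> \<open>This is the logarithm of capacity over \<open>c\<close>. It pays
    \<open>\<delta> / 16\<close> for near minimality, \<open>\<delta> / 16\<close> for close pairs,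
    \<open>\<delta> / 8\<close> for moving the points and \<open>\<delta> / 8\<close> for the mass
    of the windows; the remaining \<open>5 * \<delta> / 8\<close> goes into the choice of
    \<open>k\<close>.\<close>
  define \<delta> where "\<delta> = ln D - J - ln c"
  have \<delta>: "0 < \<delta>"
  proof -
    have "c < D * exp (- J)" using log_capacity_eq_exp_kern_robin[OF Eb D diam J] c by simp
    then have "ln c < ln (D * exp (- J))" using c D0 by (subst ln_less_cancel_iff) auto
    then show ?thesis using D0 ln_mult_pos[of D "exp (- J)"] by (simp add: \<delta>_def)
  qed
  obtain \<nu> R where nu: "\<nu> \<in> prob_on E" and R: "0 < R"
    and dens: "\<And>A. A\<in>sets borel \<Longrightarrow> emeasure \<nu> A \<le> ennreal R * emeasure lborel A"
    and en: "kern_energy D \<nu> \<le> ennreal (J + \<delta> / 16)"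
    using exists_bounded_density_near_robin[OF thick D0 Eb J, of "\<delta> / 16"] \<delta> by auto
  obtain B where B: "\<And>x. x \<in> E \<Longrightarrow> \<bar>x\<bar> \<le> B"
    using compact_imp_bounded[OF E(1)] unfolding bounded_iff by auto
  define b where "b = max 1 (max b0 (B + 1))"
  have b: "1 \<le> b" "\<And>x. x \<in> E \<Longrightarrow> \<bar>x\<bar> + 1 \<le> b" "AE x in \<mu>. \<bar>x\<bar> \<le> b"
    using B mu(3) by (fastforce simp: b_def elim!: eventually_mono)+
  \<comment> \<open>Solves \<open>1 - 2 / S = exp (- \<delta> / 8)\<close>.\<close>
  define S where "S = 2 / (1 - exp (- \<delta> / 8))"
  have e1: "exp (- \<delta> / 8) < 1" using \<delta> by simp
  then have S: "2 < S" by (simp add: S_def field_simps)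
  have "2 / S = 1 - exp (- \<delta> / 8)" unfolding S_def by (simp only: divide_divide_eq_right) simp
  then have lnS: "ln (1 - 2 / S) = - \<delta> / 8" by simp
  define W where "W = \<bar>ln b - (ln c + \<delta> / 8)\<bar>"
  \<comment> \<open>Large \<open>k\<close> makes two losses negligible: the \<open>n\<close> spare
    points, through \<open>(k + 1)^2 - k^2 \<le> 3 * k\<close>, and the powers of \<open>x\<close>,
    through \<open>2 * k * W\<close>.\<close>
  obtain k0 where k0: "(2 * W + 3 * (J + \<delta> / 8)) / (5 * \<delta> / 8) < real k0"
    using reals_Archimedean2 by blast
  define k where "k = max 1 k0"
  have k: "1 \<le> k" by (simp add: k_def)
  have "(2 * W + 3 * (J + \<delta> / 8)) / (5 * \<delta> / 8) < real k" using k0 by (simp add: k_def)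
  then have kk: "2 * W + 3 * (J + \<delta> / 8) < real k * (5 * \<delta> / 8)" using \<delta> by (simp add: field_simps)
  have kbig: "(real k + 1)\<^sup>2 * (J + \<delta> / 8) + 2 * real k * W < (real k)\<^sup>2 * (J + 3 * \<delta> / 4)"
  proof -
    have "real k * (2 * W + 3 * (J + \<delta> / 8)) < real k * (real k * (5 * \<delta> / 8))"
      using k kk by (intro mult_strict_left_mono) auto
    moreover have "1 * (J + \<delta> / 8) \<le> real k * (J + \<delta> / 8)" using k J \<delta> by (intro mult_right_mono) auto
    ultimately show ?thesis by (simp add: power2_eq_square algebra_simps)
  qed
  \<comment> \<open>The second summand pays for the energy term of \<open>\<tau>\<close>, and the 1
    for the term of the bad set, which is eventually below 1. Thus
    \<open>\<tau> \<le> al * n^2\<close>.\<close>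
  define al where "al = 1 + (real k + 1)\<^sup>2 / 2 * (J + \<delta> / 8)"
  have "0 \<le> (real k + 1)\<^sup>2 / 2 * (J + \<delta> / 8)" using J \<delta> by (intro mult_nonneg_nonneg) auto
  then have al: "0 < al" unfolding al_def by linarith
  obtain H0 where H0: "al * R * (2 * S) / (\<delta> / 16) < real H0" using reals_Archimedean2 by blast
  define H where "H = max 1 H0"
  have H: "0 < H" by (simp add: H_def)
  have "al * R * (2 * S) / (\<delta> / 16) < real H" using H0 by (simp add: H_def)
  then have HH: "al * R * (2 * S) / real H \<le> \<delta> / 16" using \<delta> H by (simp add: field_simps)
  \<comment> \<open>Chosen after \<open>H\<close>, so that the loss \<open>H * \<eta> / 2\<close>
    per degree is \<open>\<delta> / 8\<close> whatever the size of \<open>H\<close>.\<close>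
  define \<eta> where "\<eta> = \<delta> / (4 * real H)"
  have \<eta>: "0 < \<eta>" "real H * \<eta> / 2 = \<delta> / 8" using \<delta> H by (simp_all add: \<eta>_def)
  define A where "A n = {x \<in> E. measure \<mu> {x - 1 / real (H * n)..x + 1 / real (H * n)} \<le> exp (- real (H * n) * \<eta>)}" for n :: nat
  have "filterlim (\<lambda>n. H * n) at_top sequentially"
    using H by (intro filterlim_subseq strict_monoI) simp
  from filterlim_compose[OF lim[OF \<eta>(1)] this] have limA: "(\<lambda>n. measure lborel (A n)) \<longlonglongrightarrow> 0"
    unfolding A_def by simp
  \<comment> \<open>The upper minus the lower side of the final inequality, divided by
    \<open>n^2\<close>. A polynomial of too small norm forces \<open>0 \<le> f n\<close>, while the
    limit of \<open>f\<close> is negative by \<open>kbig\<close>.\<close>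
  define f where "f n = 2 * ((real k + 1) * al * R * measure lborel (A n)) + (real k + 1)\<^sup>2 * (J + \<delta> / 8)
     + 2 * real k * (ln (real k) * (1 / real n) + ln (real n) / real n) + 2 * real k * W
     - real k * (real k - 1 / real n) * (J + 3 * \<delta> / 4)" for n
  have "f \<longlonglongrightarrow> 2 * ((real k + 1) * al * R * 0) + (real k + 1)\<^sup>2 * (J + \<delta> / 8)
     + 2 * real k * (ln (real k) * 0 + 0) + 2 * real k * W - real k * (real k - 0) * (J + 3 * \<delta> / 4)"
    unfolding f_def by (intro tendsto_intros limA lim_1_over_n lim_ln_over_n)
  then have "\<forall>\<^sub>F n in sequentially. f n < 0"
    by (rule order_tendstoD) (use kbig in \<open>simp add: power2_eq_square\<close>)
  moreover have "(\<lambda>n. (real k + 1) * al * R * measure lborel (A n)) \<longlonglongrightarrow> (real k + 1) * al * R * 0"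
    by (intro tendsto_intros limA)
  then have "\<forall>\<^sub>F n in sequentially. (real k + 1) * al * R * measure lborel (A n) < 1"
    by (rule order_tendstoD) simp
  ultimately show ?thesis using eventually_gt_at_top[of 0]
  proof eventually_elim
    case (elim n)
    show ?case
    proof (intro allI impI, rule ccontr)
      fix P :: "real poly"
      assume P: "lead_coeff P = 1 \<and> degree P = n" and "\<not> c ^ n \<le> sqrt (\<integral>x. (poly P x)\<^sup>2 \<partial>\<mu>)"
      then have lt: "sqrt (\<integral>x. (poly P x)\<^sup>2 \<partial>\<mu>) < c ^ n" by simp
      define \<tau> where "\<tau> = real ((k + 1) * n) * (al * real n * (R * measure lborel (A n)))
         + (real ((k + 1) * n))\<^sup>2 / 2 * (J + \<delta> / 16 + al * real n * (R * (2 * (S / real (H * n)))))"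
      have "al * real n * (R * (2 * (S / real (H * n)))) = al * R * (2 * S) / real H"
        using elim H by simp
      then have "(real ((k + 1) * n))\<^sup>2 / 2 * (J + \<delta> / 16 + al * real n * (R * (2 * (S / real (H * n)))))
         \<le> (real ((k + 1) * n))\<^sup>2 / 2 * (J + \<delta> / 8)"
        using HH by (intro mult_left_mono) auto
      then have \<tau>: "\<tau> \<le> (real n)\<^sup>2 * ((real k + 1) * al * R * measure lborel (A n) + (real k + 1)\<^sup>2 / 2 * (J + \<delta> / 8))"
        unfolding \<tau>_def by (simp add: power2_eq_square algebra_simps)
      also have "\<dots> \<le> (real n)\<^sup>2 * al" using elim by (intro mult_left_mono) (auto simp: al_def)
      finally have small: "\<tau> \<le> al * real n * real n" by (simp add: power2_eq_square mult_ac)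
      have W: "0 \<le> W" "ln b - (ln c + real H * \<eta> / 2) \<le> W"
        unfolding \<eta>(2) by (auto simp: W_def)
      have V: "0 \<le> J + \<delta> / 16" using J \<delta> by simp
      have bd: "real (k * n) * (real (k * n) - 1) * (ln D + ln (1 - 2 / S)) - 2 * \<tau>
        \<le> (ln c + real H * \<eta> / 2) * real (k * n) * (real (k * n) - 1)
        + 2 * real (k * n) * ln (real (k * n)) + 2 * real (k * n) * real n * W"
        by (rule small_norm_energy_bound[OF nu E(1) dens en D diam mu(1,2) b(3,1,2) P[THEN conjunct1] P[THEN conjunct2] lt
            less_imp_le[OF R] V elim(3) H al S c(1) W A_def \<tau>_def small])
      have eq1: "ln D + ln (1 - 2 / S) = J + 3 * \<delta> / 4 + (ln c + real H * \<eta> / 2)"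
        unfolding lnS \<eta>(2) using \<delta>_def by linarith
      have eq2: "ln (real (k * n)) = ln (real k) + ln (real n)"
        using k elim by (simp add: ln_mult)
      have "q * (q - 1) * (a + l) - 2 * t \<le> l * q * (q - 1) + X + Y \<Longrightarrow> q * (q - 1) * a \<le> 2 * t + X + Y"
        for q a l t X Y :: real by (simp add: algebra_simps)
      from this[OF bd[unfolded eq1 eq2]] have "real (k * n) * (real (k * n) - 1) * (J + 3 * \<delta> / 4)
        \<le> 2 * \<tau> + 2 * real (k * n) * (ln (real k) + ln (real n)) + 2 * real (k * n) * real n * W" .
      also have "\<dots> \<le> 2 * ((real n)\<^sup>2 * ((real k + 1) * al * R * measure lborel (A n) + (real k + 1)\<^sup>2 / 2 * (J + \<delta> / 8)))
          + 2 * real (k * n) * (ln (real k) + ln (real n)) + 2 * real (k * n) * real n * W"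
        using \<tau> by simp
      finally have "0 \<le> (real n)\<^sup>2 * f n"
        using elim by (simp add: f_def power2_eq_square field_simps)
      then show False using elim by (simp add: zero_le_mult_iff)
    qed
  qed
qed

section \<open>Regularity\<close>

text \<open>The complement of the support is covered by open null balls, and by Lindelof countably
  many of them suffice.\<close>

lemma AE_in_msupp:
  assumes s: "sets \<mu> = sets borel"
  shows "AE x in \<mu>. x \<in> msupp \<mu>"
proof -
  define F where "F = {ball x e | x e. emeasure \<mu> (ball x e) = 0 \<and> (0::real) < e}"
  have "\<And>B. B \<in> F \<Longrightarrow> open B" by (auto simp: F_def)
  then obtain F' where F': "F' \<subseteq> F" "countable F'" "\<Union>F' = \<Union>F" by (rule Lindelof)
  have "(\<Union>B\<in>F'. B) \<in> null_sets \<mu>"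
    using F' by (intro null_sets_UN') (auto simp: F_def null_sets_def s)
  moreover have "x \<in> (\<Union>B\<in>F'. B)" if "x \<notin> msupp \<mu>" for x
  proof -
    obtain e where "0 < e" "emeasure \<mu> (ball x e) = 0"
      using \<open>x \<notin> msupp \<mu>\<close> by (auto simp: msupp_def)
    then have "ball x e \<in> F" "x \<in> ball x e" by (auto simp: F_def)
    then have "x \<in> \<Union>F" by blast
    then show ?thesis using F'(3) by simp
  qed
  ultimately show ?thesis by (intro AE_I'[of "\<Union>B\<in>F'. B"]) auto
qed

text \<open>An infinite compact remainder would have a limit point in itself, and such a point
  belongs to \<open>sigma_ess \<mu>\<close>.\<close>

lemma finite_msupp_diff_open:
  assumes "compact (msupp \<mu>)" "open U" "sigma_ess \<mu> \<subseteq> U"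
  shows "finite (msupp \<mu> - U)"
proof (rule ccontr)
  assume "infinite (msupp \<mu> - U)"
  moreover have "compact (msupp \<mu> - U)" using assms by (intro compact_diff)
  ultimately obtain x where "x \<in> msupp \<mu> - U" "x islimpt msupp \<mu> - U"
    unfolding compact_eq_Bolzano_Weierstrass by blast
  then have "x \<in> sigma_ess \<mu>" by (auto simp: sigma_ess_def intro: islimpt_subset)
  then show False using assms \<open>x \<in> msupp \<mu> - U\<close> by auto
qed

lemma monic_OP_norm_le:
  fixes P :: "real poly"
  assumes s: "sets \<mu> = sets borel" and fin: "emeasure \<mu> UNIV < \<infinity>"
    and P: "lead_coeff P = 1" "degree P = n" and C: "0 \<le> C" "AE x in \<mu>. \<bar>poly P x\<bar> \<le> C"
  shows "monic_OP_norm \<mu> n \<le> C * sqrt (measure \<mu> UNIV)"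
proof -
  have sp: "space \<mu> = UNIV" using sets_eq_imp_space_eq[OF s] by simp
  interpret finite_measure \<mu> using fin by (intro finite_measureI) (simp add: sp)
  note [measurable_cong] = s
  have [measurable]: "(\<lambda>x. poly P x) \<in> borel_measurable borel"
    by (intro borel_measurable_continuous_onI continuous_intros)
  have le: "AE x in \<mu>. (poly P x)\<^sup>2 \<le> C\<^sup>2"
    using C(2) by (rule eventually_mono) (use C(1) in \<open>simp add: abs_le_square_iff[symmetric]\<close>)
  have "integrable \<mu> (\<lambda>x. (poly P x)\<^sup>2)"
    by (rule integrable_const_bound[where B = "C\<^sup>2"]) (use le in auto)
  then have "(\<integral>x. (poly P x)\<^sup>2 \<partial>\<mu>) \<le> (\<integral>x. C\<^sup>2 \<partial>\<mu>)"
    by (rule integral_mono_AE) (use le in auto)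
  then have "sqrt (\<integral>x. (poly P x)\<^sup>2 \<partial>\<mu>) \<le> sqrt (C\<^sup>2 * measure \<mu> UNIV)"
    by (simp add: sp mult.commute)
  also have "\<dots> = C * sqrt (measure \<mu> UNIV)" using C by (simp add: real_sqrt_mult)
  finally have "sqrt (\<integral>x. (poly P x)\<^sup>2 \<partial>\<mu>) \<le> C * sqrt (measure \<mu> UNIV)" .
  moreover have "monic_OP_norm \<mu> n \<le> sqrt (\<integral>x. (poly P x)\<^sup>2 \<partial>\<mu>)"
    unfolding monic_OP_norm_def
    by (rule cINF_lower) (use P in \<open>auto intro!: bdd_belowI[of _ 0]\<close>)
  ultimately show ?thesis by linarith
qed

lemma monic_OP_norm_ge:
  assumes "\<And>P :: real poly. lead_coeff P = 1 \<Longrightarrow> degree P = n \<Longrightarrow> r \<le> sqrt (\<integral>x. (poly P x)\<^sup>2 \<partial>\<mu>)"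
  shows "r \<le> monic_OP_norm \<mu> n"
  unfolding monic_OP_norm_def
proof (rule cINF_greatest)
  have "monom 1 n \<in> {p :: real poly. degree p = n \<and> lead_coeff p = 1}" by (simp add: degree_monom_eq)
  then show "{p :: real poly. degree p = n \<and> lead_coeff p = 1} \<noteq> {}" by blast
qed (use assms in auto)

text \<open>Powers of a polynomial that is small on the essential support are multiplied by the
  factors vanishing at the finitely many support points where it is not small.\<close>

lemma eventually_monic_OP_norm_le:
  assumes s: "sets \<mu> = sets borel" and fin: "emeasure \<mu> UNIV < \<infinity>"
    and comp: "compact (msupp \<mu>)" and E: "sigma_ess \<mu> \<subseteq> E"
    and c: "0 < c1" "c1 < c"
    and T: "lead_coeff T = 1" "0 < degree T" "\<forall>x\<in>E. \<bar>poly T x\<bar> \<le> c1 ^ degree T"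
  shows "\<exists>C>0. \<forall>\<^sub>F n in sequentially. monic_OP_norm \<mu> n \<le> C * c ^ n"
proof -
  define k where "k = degree T"
  have k: "0 < k" using T by (simp add: k_def)
  \<comment> \<open>The gap between \<open>c1\<close> and \<open>c\<close> enlarges \<open>E\<close>
    to an open set, outside of which only finitely many support points remain.\<close>
  define U where "U = {x. \<bar>poly T x\<bar> < c ^ k}"
  have "open U" unfolding U_def by (intro open_Collect_less continuous_intros)
  moreover have "E \<subseteq> U"
  proof
    fix x assume "x \<in> E"
    then have "\<bar>poly T x\<bar> \<le> c1 ^ k" using T by (simp add: k_def)
    also have "\<dots> < c ^ k" using c k by (intro power_strict_mono) auto
    finally show "x \<in> U" by (simp add: U_def)
  qed
  ultimately have finF: "finite (msupp \<mu> - U)" using finite_msupp_diff_open[OF comp] E by blast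
  define G where "G = (\<Prod>z\<in>msupp \<mu> - U. [:- z, 1:])"
  define m where "m = card (msupp \<mu> - U)"
  have G: "lead_coeff G = 1" "degree G = m" "\<And>x. poly G x = (\<Prod>z\<in>msupp \<mu> - U. x - z)"
    unfolding G_def m_def by (rule monic_prod_linear[OF finF])+
  have "compact (poly G ` msupp \<mu>)" by (intro compact_continuous_image continuous_intros comp)
  then have "bounded (poly G ` msupp \<mu>)" by (rule compact_imp_bounded)
  then obtain g where g: "\<And>x. x \<in> msupp \<mu> \<Longrightarrow> \<bar>poly G x\<bar> \<le> g"
    unfolding bounded_iff by auto
  obtain b0 where "\<And>x. x \<in> msupp \<mu> \<Longrightarrow> \<bar>x\<bar> \<le> b0"
    using compact_imp_bounded[OF comp] unfolding bounded_iff by auto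
  then obtain b where b: "1 \<le> b" "\<And>x. x \<in> msupp \<mu> \<Longrightarrow> \<bar>x\<bar> \<le> b"
    by (metis max.cobounded1 max.coboundedI2)
  have c0: "0 < c" using c by simp
  \<comment> \<open>Compensates the at most \<open>m + k\<close> degrees not supplied by powers of
    \<open>T\<close>; \<open>max 1\<close> covers \<open>c\<close> on either side of 1.\<close>
  define K where "K = max 1 (1 / c) ^ (m + k)"
  define C where "C = K * \<bar>g\<bar> * b ^ k"
  have K: "1 \<le> K" by (simp add: K_def)
  have C: "0 \<le> C" using b K by (simp add: C_def)
  have key: "monic_OP_norm \<mu> n \<le> C * c ^ n * sqrt (measure \<mu> UNIV)" if n: "m \<le> n" for n
  proof -
    define j r where "j = (n - m) div k" and "r = (n - m) mod k"
    have nm: "n - m = j * k + r" by (simp add: j_def r_def)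
    have njr: "n = k * j + (m + r)" using nm n by (simp add: mult.commute)
    have rk: "r < k" using k by (simp add: r_def)
    define P where "P = (T ^ j * [:0, 1:] ^ r) * G"
    have Q: "lead_coeff (T ^ j * [:0, 1:] ^ r) = 1" "degree (T ^ j * [:0, 1:] ^ r) = j * k + r"
      by (rule monic_power_times_X_power[OF T(1)], simp add: k_def)+
    then have nz: "T ^ j * [:0, 1:] ^ r \<noteq> 0" "G \<noteq> 0" using G(1) by (auto simp del: mult_eq_0_iff)
    have P: "lead_coeff P = 1" "degree P = n"
    proof -
      show "lead_coeff P = 1" unfolding P_def lead_coeff_mult[of _ G] Q(1) G(1) by simp
      show "degree P = n" unfolding P_def degree_mult_eq[OF nz] Q(2) G(2) using njr by simp
    qed
    have bound: "\<bar>poly P x\<bar> \<le> C * c ^ n" if x: "x \<in> msupp \<mu>" for x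
    proof (cases "x \<in> U")
      case True
      have "\<bar>poly P x\<bar> = \<bar>poly T x\<bar> ^ j * \<bar>x\<bar> ^ r * \<bar>poly G x\<bar>"
        by (simp add: P_def abs_mult power_abs)
      also have "\<dots> \<le> (c ^ k) ^ j * b ^ k * \<bar>g\<bar>"
      proof (intro mult_mono)
        show "\<bar>poly T x\<bar> ^ j \<le> (c ^ k) ^ j" using True by (intro power_mono) (auto simp: U_def)
        have "\<bar>x\<bar> ^ r \<le> b ^ r" using b(2)[OF x] by (intro power_mono) auto
        also have "\<dots> \<le> b ^ k" using b rk by (intro power_increasing) auto
        finally show "\<bar>x\<bar> ^ r \<le> b ^ k" .
        show "\<bar>poly G x\<bar> \<le> \<bar>g\<bar>" using g[OF x] by simp
      qed (use b c0 in auto)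
      also have "(c ^ k) ^ j \<le> K * c ^ n"
      proof -
        have "1 = (1 / c) ^ (m + r) * c ^ (m + r)" using c0 by (simp add: power_divide)
        also have "\<dots> \<le> K * c ^ (m + r)"
        proof (rule mult_right_mono)
          have "(1 / c) ^ (m + r) \<le> max 1 (1 / c) ^ (m + r)" using c0 by (intro power_mono) auto
          also have "\<dots> \<le> K" unfolding K_def using rk by (intro power_increasing) auto
          finally show "(1 / c) ^ (m + r) \<le> K" .
        qed (use c0 in simp)
        finally have "c ^ (k * j) * 1 \<le> c ^ (k * j) * (K * c ^ (m + r))"
          using c0 by (intro mult_left_mono) auto
        also have "\<dots> = K * c ^ n" by (subst njr) (simp add: power_add mult_ac)
        finally show ?thesis by (simp add: power_mult)
      qed
      finally show ?thesis using b by (simp add: C_def mult_ac mult_right_mono)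
    next
      case False
      then have "poly G x = 0" using x finF by (auto simp: G(3) prod_zero_iff)
      then have "poly P x = 0" by (simp add: P_def)
      then show ?thesis using C c0 by simp
    qed
    have "AE x in \<mu>. \<bar>poly P x\<bar> \<le> C * c ^ n"
      using AE_in_msupp[OF s] by (rule eventually_mono) (rule bound)
    then show ?thesis using monic_OP_norm_le[OF s fin P] C c0 by simp
  qed
  show ?thesis
  proof (intro exI[of _ "C * sqrt (measure \<mu> UNIV) + 1"] conjI)
    show "0 < C * sqrt (measure \<mu> UNIV) + 1" using C by (intro add_nonneg_pos mult_nonneg_nonneg) auto
    show "\<forall>\<^sub>F n in sequentially. monic_OP_norm \<mu> n \<le> (C * sqrt (measure \<mu> UNIV) + 1) * c ^ n"
      using eventually_ge_at_top[of m]
    proof eventually_elim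
      case (elim n)
      have "C * c ^ n * sqrt (measure \<mu> UNIV) \<le> (C * sqrt (measure \<mu> UNIV) + 1) * c ^ n"
        using c0 by (simp add: algebra_simps)
      then show ?case using key[OF elim] by linarith
    qed
  qed
qed

text \<open>The window of length \<open>r\<close> ending at \<open>x\<close> is pushed right to
  start at \<open>a j\<close> if it sticks out; it then still fits, since \<open>r0\<close> is the
  shortest length.\<close>

lemma thick_at_scale_finite_Union_intervals:
  fixes a b :: "nat \<Rightarrow> real"
  assumes "1 \<le> n" "\<And>j. j < n \<Longrightarrow> a j < b j"
  shows "\<exists>r0. thick_at_scale r0 (\<Union>j<n. {a j..b j})"
proof -
  define r0 where "r0 = Min ((\<lambda>j. b j - a j) ` {..<n})"
  have ne: "(\<lambda>j. b j - a j) ` {..<n} \<noteq> {}" using assms(1) by (auto simp: lessThan_empty_iff)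
  have "0 < r0" unfolding r0_def using assms ne by (subst Min_gr_iff) auto
  moreover have "\<exists>u. u \<le> x \<and> x \<le> u + r \<and> {u..u + r} \<subseteq> (\<Union>j<n. {a j..b j})"
    if x: "x \<in> (\<Union>j<n. {a j..b j})" and r: "0 < r" "r \<le> r0" for x r
  proof -
    obtain j where j: "j < n" "a j \<le> x" "x \<le> b j" using x by auto
    have "r0 \<le> b j - a j" unfolding r0_def using j by (intro Min_le) auto
    then have u: "max (a j) (x - r) \<le> x" "x \<le> max (a j) (x - r) + r" "max (a j) (x - r) + r \<le> b j"
      using r j by auto
    then have "{max (a j) (x - r)..max (a j) (x - r) + r} \<subseteq> {a j..b j}" by auto
    then have "{max (a j) (x - r)..max (a j) (x - r) + r} \<subseteq> (\<Union>j<n. {a j..b j})" using j by blast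
    then show ?thesis using u by blast
  qed
  ultimately show ?thesis unfolding thick_at_scale_def by blast
qed

theorem theorem1p11:
  fixes \<mu> :: "real measure" and E :: "real set"
    and n :: nat and a b :: "nat \<Rightarrow> real"
  assumes "n \<ge> 1"
    and "\<And>j. j < n \<Longrightarrow> a j < b j"
    and "\<And>i j. i < n \<Longrightarrow> j < n \<Longrightarrow> i \<noteq> j \<Longrightarrow> {a i..b i} \<inter> {a j..b j} = {}"
    and "E = (\<Union>j<n. {a j..b j})"
    and "sets \<mu> = sets borel"
    and "emeasure \<mu> UNIV < \<infinity>"
    and "compact (msupp \<mu>)"
    and "sigma_ess \<mu> = E"
    and "\<And>\<eta>::real. \<eta> > 0 \<Longrightarrow>
          (\<lambda>m::nat. measure lborel
              {x \<in> E. measure \<mu> {x - 1 / real m .. x + 1 / real m} \<le> exp (- real m * \<eta>)})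
          \<longlonglongrightarrow> 0"
  shows "regular_measure \<mu>"
proof -
  obtain r0 where thick: "thick_at_scale r0 E"
    using thick_at_scale_finite_Union_intervals[of n a b] assms(1,2,4) by blast
  have E: "compact E" unfolding assms(4) by (intro compact_UN) auto
  have "a 0 \<in> E" using assms(1) assms(2)[of 0] by (auto simp: assms(4) intro!: bexI[of _ 0])
  then have ne: "E \<noteq> {}" by auto
  obtain B where B: "\<And>x. x \<in> E \<Longrightarrow> \<bar>x\<bar> \<le> B"
    using compact_imp_bounded[OF E] unfolding bounded_iff by auto
  \<comment> \<open>The \<open>+ 1\<close> ensures \<open>0 \<le> ln D\<close>, so that the shift of
    the kernel is nonnegative.\<close>
  define D where "D = 2 * \<bar>B\<bar> + 1"
  have D: "1 \<le> D" by (simp add: D_def)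
  have diam: "\<bar>x - y\<bar> \<le> D" if "x \<in> E" "y \<in> E" for x y
    using B[OF that(1)] B[OF that(2)] by (simp add: D_def)
  obtain b0 where "\<And>x. x \<in> msupp \<mu> \<Longrightarrow> \<bar>x\<bar> \<le> b0"
    using compact_imp_bounded[OF assms(7)] unfolding bounded_iff by auto
  then have b0: "AE x in \<mu>. \<bar>x\<bar> \<le> b0" using AE_in_msupp[OF assms(5)] by (auto elim!: eventually_mono)
  have cap: "0 < log_capacity E"
  proof -
    have Eb: "E \<in> sets borel" using E by (simp add: borel_compact)
    obtain J where J: "kern_robin D E = ennreal J" "0 \<le> J"
      using kern_robin_finite[OF thick _ Eb ne, of D] D by (cases "kern_robin D E") auto
    show ?thesis using log_capacity_eq_exp_kern_robin[OF Eb D diam J] D by simp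
  qed
  have "(\<lambda>n. monic_OP_norm \<mu> n powr (1 / real n)) \<longlonglongrightarrow> log_capacity E"
  proof (rule order_tendstoI)
    fix l assume l: "l < log_capacity E"
    \<comment> \<open>\<open>l\<close> may be negative, but \<open>c\<close> must be positive for
      logarithms and roots.\<close>
    obtain c where c: "max l 0 < c" "c < log_capacity E" using dense[of "max l 0" "log_capacity E"] l cap by auto
    have c0: "0 < c" using c by simp
    have "\<forall>\<^sub>F n in sequentially. \<forall>P :: real poly. lead_coeff P = 1 \<and> degree P = n \<longrightarrow>
        c ^ n \<le> sqrt (\<integral>x. (poly P x)\<^sup>2 \<partial>\<mu>)"
      by (rule eventually_monic_norm_ge[OF thick E ne D diam assms(5,6) b0 assms(9) c0 c(2)])
    then show "\<forall>\<^sub>F n in sequentially. l < monic_OP_norm \<mu> n powr (1 / real n)"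
      using eventually_gt_at_top[of 0]
    proof eventually_elim
      case (elim n)
      have "c ^ n \<le> monic_OP_norm \<mu> n" by (rule monic_OP_norm_ge) (use elim in auto)
      then have "(c ^ n) powr (1 / real n) \<le> monic_OP_norm \<mu> n powr (1 / real n)"
        using c0 by (intro powr_mono2) auto
      moreover have "(c ^ n) powr (1 / real n) = c"
        using c0 elim(2) by (simp add: powr_realpow[symmetric] powr_powr)
      ultimately show ?case using c by simp
    qed
  next
    fix u assume u: "log_capacity E < u"
    obtain c where c: "log_capacity E < c" "c < u" using dense[OF u] by auto
    obtain c1 where c1: "log_capacity E < c1" "c1 < c" using dense[OF c(1)] by auto
    have c0: "0 < c" "0 < c1" using c c1 cap by auto
    obtain T :: "real poly" where T: "lead_coeff T = 1" "0 < degree T" "\<forall>x\<in>E. \<bar>poly T x\<bar> \<le> c1 ^ degree T"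
      using exists_monic_small_on[OF thick E ne D diam c1(1)] by blast
    obtain C where C: "0 < C" "\<forall>\<^sub>F n in sequentially. monic_OP_norm \<mu> n \<le> C * c ^ n"
      using eventually_monic_OP_norm_le[OF assms(5,6,7) _ c0(2) c1(2) T] assms(8) by auto
    \<comment> \<open>The constant factor disappears in the \<open>n\<close>-th root, and
      \<open>c < u\<close> remains.\<close>
    have "(\<lambda>n. C powr (1 / real n) * c) \<longlonglongrightarrow> C powr 0 * c"
      using C by (intro tendsto_intros lim_1_over_n) auto
    then have "\<forall>\<^sub>F n in sequentially. C powr (1 / real n) * c < u"
      by (rule order_tendstoD) (use C c in simp)
    then show "\<forall>\<^sub>F n in sequentially. monic_OP_norm \<mu> n powr (1 / real n) < u"
      using C(2) eventually_gt_at_top[of 0]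
    proof eventually_elim
      case (elim n)
      have "0 \<le> monic_OP_norm \<mu> n" by (rule monic_OP_norm_ge) simp
      then have "monic_OP_norm \<mu> n powr (1 / real n) \<le> (C * c ^ n) powr (1 / real n)"
        using elim(2) by (intro powr_mono2) auto
      also have "\<dots> = C powr (1 / real n) * c"
        using C c0 elim(3) by (simp add: powr_mult powr_realpow[symmetric] powr_powr)
      finally show ?case using elim(1) by linarith
    qed
  qed
  then show ?thesis unfolding regular_measure_def assms(8) .
qed

end
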